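(* The clustering problem without replication with cluster capacity $M=2$, in which all vertex weights are $1$ and all vertex delays are $0$, admits a polynomial-time $2$-approximation algorithm.
   Context: Clustering problem: given a directed acyclic graph $G=(V,E)$, an intra-cluster delay $d$, an inter-cluster delay $D>d$ and capacity $M=2$, partition $V$ into pairwise disjoint clusters of at most $2$ vertices each, minimizing the delay of the network. Given a clustering, an arc $(u,v)$ has delay $d$ if $u,v$ lie in the same cluster and $D$ otherwise; the delay of a directed path is the sum of its arc delays; the delay of the network is the maximum delay of a directed path from a source (in-degree $0$ vertex) to a sink (out-degree $0$ vertex). A $2$-approximation algorithm outputs a feasible clustering whose network delay is at most twice the optimum. *)

theory Defs
  imports
    "Graph_Theory.Pair_Digraph"
    "HOL-Library.Disjoint_Sets"
    "HOL-Library.Log_Nat"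
    "HOL-Computational_Algebra.Polynomial"
begin

section \<open>The clustering problem without replication\<close>

text \<open>All numeric data are rational, since they are part of the input of an algorithm.\<close>

record 'v clustering_instance =
  network :: "'v pair_pre_digraph"
  weight :: "'v \<Rightarrow> rat"
  vertex_delay :: "'v \<Rightarrow> rat"
  capacity :: rat
  intra_delay :: rat
  inter_delay :: rat

definition clustering_problem :: "'v clustering_instance \<Rightarrow> bool" where
  "clustering_problem I \<longleftrightarrow>
     pair_fin_digraph (network I) \<and> pverts (network I) \<noteq> {} \<and> acyclic (parcs (network I)) \<and>
     (\<forall>v\<in>pverts (network I). 0 \<le> weight I v \<and> 0 \<le> vertex_delay I v) \<and>
     0 \<le> capacity I \<and> 0 \<le> intra_delay I \<and> intra_delay I < inter_delay I"

definition feasible_clustering :: "'v clustering_instance \<Rightarrow> 'v set set \<Rightarrow> bool" where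
  "feasible_clustering I P \<longleftrightarrow>
     partition_on (pverts (network I)) P \<and> (\<forall>C\<in>P. sum (weight I) C \<le> capacity I)"

definition arc_delay :: "'v clustering_instance \<Rightarrow> 'v set set \<Rightarrow> 'v \<times> 'v \<Rightarrow> rat" where
  "arc_delay I P e =
     (if \<exists>C\<in>P. fst e \<in> C \<and> snd e \<in> C then intra_delay I else inter_delay I)"

text \<open>A path is given by its start vertex and its list of arcs.\<close>

definition path_delay ::
  "'v clustering_instance \<Rightarrow> 'v set set \<Rightarrow> 'v \<Rightarrow> ('v \<times> 'v) list \<Rightarrow> rat" where
  "path_delay I P u p =
     (\<Sum>v\<leftarrow>pre_digraph.awalk_verts (with_proj (network I)) u p. vertex_delay I v) +
     (\<Sum>e\<leftarrow>p. arc_delay I P e)"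

definition is_source :: "'v pair_pre_digraph \<Rightarrow> 'v \<Rightarrow> bool" where
  "is_source G v \<longleftrightarrow> v \<in> pverts G \<and> in_degree (with_proj G) v = 0"

definition is_sink :: "'v pair_pre_digraph \<Rightarrow> 'v \<Rightarrow> bool" where
  "is_sink G v \<longleftrightarrow> v \<in> pverts G \<and> out_degree (with_proj G) v = 0"

definition network_delay :: "'v clustering_instance \<Rightarrow> 'v set set \<Rightarrow> rat" where
  "network_delay I P =
     Max {path_delay I P u p | u p v.
            is_source (network I) u \<and> is_sink (network I) v \<and>
            pre_digraph.apath (with_proj (network I)) u p v}"

definition optimal_delay :: "'v clustering_instance \<Rightarrow> rat" where
  "optimal_delay I = Min (network_delay I ` {P. feasible_clustering I P})"

section \<open>Random access machine with logarithmic cost\<close>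

text \<open>
  A state consists of registers and a memory, both holding natural numbers of arbitrary size.
  Memory is addressed indirectly; the arithmetic operations are addition and truncated
  subtraction. Every operation is charged the number of binary digits of the addresses and
  values it involves (the logarithmic cost criterion), so that running time agrees with Turing
  machine time up to a polynomial.
\<close>

definition bit_length :: "nat \<Rightarrow> nat" where
  "bit_length n = max 1 (floorlog 2 n)"

type_synonym ram_state = "(nat \<Rightarrow> nat) \<times> (nat \<Rightarrow> nat)"

datatype ram_exp =
    Const nat
  | Reg nat
  | Mem ram_exp
  | Add ram_exp ram_exp
  | Sub ram_exp ram_exp

datatype ram_cond = Less ram_exp ram_exp

datatype ram_prog =
    Skip
  | Set_Reg nat ram_exp
  | Set_Mem ram_exp ram_exp
  | Seq ram_prog ram_prog
  | Ite ram_cond ram_prog ram_prog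
  | While ram_cond ram_prog

fun exp_val :: "ram_exp \<Rightarrow> ram_state \<Rightarrow> nat" where
  "exp_val (Const c) s = c"
| "exp_val (Reg r) s = fst s r"
| "exp_val (Mem a) s = snd s (exp_val a s)"
| "exp_val (Add a b) s = exp_val a s + exp_val b s"
| "exp_val (Sub a b) s = exp_val a s - exp_val b s"

fun exp_cost :: "ram_exp \<Rightarrow> ram_state \<Rightarrow> nat" where
  "exp_cost (Const c) s = bit_length c"
| "exp_cost (Reg r) s = bit_length r + bit_length (fst s r)"
| "exp_cost (Mem a) s = exp_cost a s + bit_length (snd s (exp_val a s))"
| "exp_cost (Add a b) s = exp_cost a s + exp_cost b s + bit_length (exp_val a s + exp_val b s)"
| "exp_cost (Sub a b) s = exp_cost a s + exp_cost b s + bit_length (exp_val a s - exp_val b s)"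

fun cond_val :: "ram_cond \<Rightarrow> ram_state \<Rightarrow> bool" where
  "cond_val (Less a b) s \<longleftrightarrow> exp_val a s < exp_val b s"

fun cond_cost :: "ram_cond \<Rightarrow> ram_state \<Rightarrow> nat" where
  "cond_cost (Less a b) s = exp_cost a s + exp_cost b s"

text \<open>\<open>ram_exec c s t s'\<close>: started in \<open>s\<close>, the program \<open>c\<close> halts in \<open>s'\<close> at total cost \<open>t\<close>.\<close>

inductive ram_exec :: "ram_prog \<Rightarrow> ram_state \<Rightarrow> nat \<Rightarrow> ram_state \<Rightarrow> bool" where
  exec_Skip: "ram_exec Skip s 1 s"
| exec_Set_Reg:
    "ram_exec (Set_Reg r a) s (bit_length r + exp_cost a s) ((fst s)(r := exp_val a s), snd s)"
| exec_Set_Mem: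
    "ram_exec (Set_Mem a b) s (exp_cost a s + exp_cost b s)
       (fst s, (snd s)(exp_val a s := exp_val b s))"
| exec_Seq:
    "ram_exec c1 s1 t1 s2 \<Longrightarrow> ram_exec c2 s2 t2 s3 \<Longrightarrow> ram_exec (Seq c1 c2) s1 (t1 + t2) s3"
| exec_Ite_True:
    "cond_val b s \<Longrightarrow> ram_exec c1 s t s' \<Longrightarrow> ram_exec (Ite b c1 c2) s (cond_cost b s + t) s'"
| exec_Ite_False:
    "\<not> cond_val b s \<Longrightarrow> ram_exec c2 s t s' \<Longrightarrow> ram_exec (Ite b c1 c2) s (cond_cost b s + t) s'"
| exec_While_False:
    "\<not> cond_val b s \<Longrightarrow> ram_exec (While b c) s (cond_cost b s) s"
| exec_While_True:
    "cond_val b s1 \<Longrightarrow> ram_exec c s1 t1 s2 \<Longrightarrow> ram_exec (While b c) s2 t2 s3 \<Longrightarrow>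
     ram_exec (While b c) s1 (cond_cost b s1 + t1 + t2) s3"

text \<open>
  Input and output are lists of numbers stored in memory from address 0 on, with the length of
  the list in register 0.
\<close>

definition ram_input :: "nat list \<Rightarrow> ram_state" where
  "ram_input xs =
     ((\<lambda>_. 0)(0 := length xs), (\<lambda>i. if i < length xs then xs ! i else 0))"

definition ram_output :: "ram_state \<Rightarrow> nat list" where
  "ram_output s = map (snd s) [0..<fst s 0]"

definition ram_computes :: "ram_prog \<Rightarrow> nat list \<Rightarrow> nat \<Rightarrow> nat list \<Rightarrow> bool" where
  "ram_computes c xs t ys \<longleftrightarrow> (\<exists>s. ram_exec c (ram_input xs) t s \<and> ram_output s = ys)"

section \<open>Polynomial-time approximation\<close>

text \<open>
  For the purpose of encoding, the vertices of a network with \<open>n\<close> vertices are numbered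
  \<open>0, \<dots>, n - 1\<close>. The network is given by its adjacency matrix (row by row), and a nonnegative
  rational by numerator and denominator in lowest terms.
\<close>

definition encode_rat :: "rat \<Rightarrow> nat list" where
  "encode_rat r = [nat (fst (quotient_of r)), nat (snd (quotient_of r))]"

definition encode_instance :: "nat clustering_instance \<Rightarrow> nat list" where
  "encode_instance I =
     (let n = card (pverts (network I)) in
        [n] @ encode_rat (capacity I) @ encode_rat (intra_delay I) @ encode_rat (inter_delay I) @
        concat (map (\<lambda>v. encode_rat (weight I v)) [0..<n]) @
        concat (map (\<lambda>v. encode_rat (vertex_delay I v)) [0..<n]) @
        concat (map (\<lambda>u. map (\<lambda>v. if (u, v) \<in> parcs (network I) then 1 else 0) [0..<n]) [0..<n]))"

definition input_size :: "nat list \<Rightarrow> nat" where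
  "input_size xs = (\<Sum>x\<leftarrow>xs. bit_length x)"

text \<open>
  A list of length \<open>n\<close> represents the clustering of \<open>{0..<n}\<close> in which two vertices share a
  cluster iff they carry the same label.
\<close>

definition decode_clustering :: "nat list \<Rightarrow> nat set set" where
  "decode_clustering ys =
     (\<lambda>i. {j. j < length ys \<and> ys ! j = ys ! i}) ` {..<length ys}"

definition poly_time_approximable :: "rat \<Rightarrow> nat clustering_instance set \<Rightarrow> bool" where
  "poly_time_approximable \<rho> S \<longleftrightarrow>
     (\<exists>(c :: ram_prog) (q :: nat poly). \<forall>I\<in>S.
        pverts (network I) = {..<card (pverts (network I))} \<longrightarrow>
        (\<exists>t ys. ram_computes c (encode_instance I) t ys \<and>
           t \<le> poly q (input_size (encode_instance I)) \<and>
           feasible_clustering I (decode_clustering ys) \<and>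
           network_delay I (decode_clustering ys) \<le> \<rho> * optimal_delay I))"

end

theory Submission
  imports Defs
begin

text \<open>
  A cluster of a feasible clustering contains at most one arc, so two consecutive arcs of a path are
  never both inside clusters. If the longest path has \<open>L\<close> arcs, every clustering has delay at most
  \<open>L D\<close>. For \<open>L = 2k\<close> the optimum is at least \<open>k (d + D)\<close>, so every clustering will do. For
  \<open>L = 2k + 1\<close> either the optimum is at least \<open>k d + (k + 1) D\<close>, and again every clustering will
  do, or an optimal clustering contains all arcs at even positions of the longest paths. In the
  latter case these arcs form a matching. Clustering along it is good enough: the longest paths then
  have the least possible delay \<open>(k + 1) d + k D\<close>, and shorter paths have delay at most \<open>2 k D\<close>.
  Hence it suffices to match these arcs greedily. They are recognised from the lengths of the
  longest walks ending and starting in each vertex, found by \<open>n\<close> rounds of relaxation.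
\<close>

section \<open>Longest walks\<close>

text \<open>The obstacle is odd length. As only \<open>0 \<le> d\<close> is known, a lower bound for
  the optimum can rely on little more than \<open>k D\<close>. That is half of the trivial cost
  \<open>2 k D\<close> for an even longest path, but less than half of \<open>(2 k + 1) D\<close>;
  for \<open>k = 0\<close> and \<open>d = 0\<close> the ratio is even unbounded. So one more
  \<open>D\<close> must be found in the optimum or saved on every longest path of the output. The
  program never learns which of the two happens: of the instance it reads the number of vertices and
  the arcs, but neither \<open>d\<close> nor \<open>D\<close>, and it always runs the same greedy
  matching. If critical arcs that meet have the same pair of ends, greedy covers all of them;
  otherwise no feasible clustering does, and for odd length the optimum is large. The output is
  therefore compared with an arbitrary feasible clustering, from which the matching property is
  inferred when it is needed. The machine only adds and subtracts. Parities and matrix addresses are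
  carried along incrementally.\<close>

lemma pcas_append: "pcas u (p @ q) w \<longleftrightarrow> (\<exists>v. pcas u p v \<and> pcas v q w)"
  by (induction p arbitrary: u) auto

text \<open>Delays live on arc lists, while the program computes only lengths of walks; relation
  powers are the interface between the two.\<close>

lemma relpow_iff_pcas:
  "(u, v) \<in> E ^^ k \<longleftrightarrow> (\<exists>p. pcas u p v \<and> set p \<subseteq> E \<and> length p = k)"
proof (induction k arbitrary: u)
  case (Suc k)
  have "(u, v) \<in> E ^^ Suc k \<longleftrightarrow> (\<exists>w. (u, w) \<in> E \<and> (w, v) \<in> E ^^ k)"
    by (auto simp: relpow_commute simp del: relpow.simps elim: relpow_Suc_E2 intro: relpow_Suc_I2)
  also have "\<dots> \<longleftrightarrow> (\<exists>w p. (u, w) \<in> E \<and> pcas w p v \<and> set p \<subseteq> E \<and> length p = k)"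
    using Suc.IH by blast
  also have "\<dots> \<longleftrightarrow> (\<exists>p. pcas u p v \<and> set p \<subseteq> E \<and> length p = Suc k)"
  proof (intro iffI; elim exE conjE)
    fix w p assume "(u, w) \<in> E" "pcas w p v" "set p \<subseteq> E" "length p = k"
    then show "\<exists>p. pcas u p v \<and> set p \<subseteq> E \<and> length p = Suc k"
      by (intro exI[of _ "(u, w) # p"]) auto
  next
    fix p assume "pcas u p v" "set p \<subseteq> E" "length p = Suc k"
    then show "\<exists>w p. (u, w) \<in> E \<and> pcas w p v \<and> set p \<subseteq> E \<and> length p = k"
      by (cases p) force+
  qed
  finally show ?case .
qed auto

definition is_longest :: "'v rel \<Rightarrow> nat \<Rightarrow> bool" where
  "is_longest E L \<longleftrightarrow> E ^^ L \<noteq> {} \<and> (\<forall>k. E ^^ k \<noteq> {} \<longrightarrow> k \<le> L)"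

text \<open>The arcs at the even positions, counted from 0, of the walks of length \<open>L\<close>.\<close>

definition critical_arcs :: "'v rel \<Rightarrow> nat \<Rightarrow> 'v rel" where
  "critical_arcs E L = {(u, v) \<in> E. \<exists>i j. even i \<and> u \<in> Range (E ^^ i) \<and> v \<in> Domain (E ^^ j) \<and>
     Suc (i + j) = L}"

lemma nth_in_critical_arcs:
  assumes "pcas u p v" "set p \<subseteq> E" "i < length p" "even i"
  shows "p ! i \<in> critical_arcs E (length p)"
proof -
  obtain x y where xy: "p ! i = (x, y)" by fastforce
  have p: "p = take i p @ (x, y) # drop (Suc i) p"
    using id_take_nth_drop[OF assms(3)] xy by simp
  then have "pcas u (take i p @ (x, y) # drop (Suc i) p) v"
    using assms(1) by simp
  then have *: "pcas u (take i p) x" "pcas y (drop (Suc i) p) v"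
    by (auto simp: pcas_append)
  have "(u, x) \<in> E ^^ i"
    unfolding relpow_iff_pcas using * assms
    by (intro exI[of _ "take i p"]) (auto dest: in_set_takeD)
  moreover have "(y, v) \<in> E ^^ (length p - Suc i)"
    unfolding relpow_iff_pcas using * assms
    by (intro exI[of _ "drop (Suc i) p"]) (auto dest: in_set_dropD)
  moreover have "(x, y) \<in> E"
    using assms xy nth_mem by force
  moreover have "Suc (i + (length p - Suc i)) = length p"
    using assms by simp
  ultimately show ?thesis
    unfolding critical_arcs_def xy using assms(4) by blast
qed

text \<open>The walk into \<open>x\<close> and the walk out of \<open>y\<close> need not stem from
  one walk, but joined by \<open>(x, y)\<close> they again have \<open>L\<close> arcs. Hence two
  numbers per vertex suffice to recognise these arcs.\<close>

lemma critical_arcsE: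
  assumes "e \<in> critical_arcs E L"
  obtains u p v i where "pcas u p v" "set p \<subseteq> E" "length p = L" "i < L" "even i" "p ! i = e"
proof -
  obtain x y i j u v where e: "e = (x, y)" "(x, y) \<in> E" "even i" "(u, x) \<in> E ^^ i"
    "(y, v) \<in> E ^^ j" "Suc (i + j) = L"
    using assms unfolding critical_arcs_def by fast
  obtain p q where "pcas u p x" "set p \<subseteq> E" "length p = i" "pcas y q v" "set q \<subseteq> E" "length q = j"
    using e unfolding relpow_iff_pcas by blast
  then show thesis
    using e by (intro that[of u "p @ (x, y) # q" v i]) (auto simp: pcas_append nth_append)
qed

section \<open>Delay of a path under a matching\<close>

text \<open>Cut into \<open>k\<close> pairs of consecutive arcs: at most one arc of each pair is
  cheap.\<close>

lemma delay_even_ge: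
  fixes d D :: rat
  assumes "length p = 2 * k" "successively (\<lambda>e f. \<not> (M e \<and> M f)) p" "d < D"
  shows "of_nat k * (d + D) \<le> (\<Sum>e\<leftarrow>p. if M e then d else D)"
  using assms(1,2)
proof (induction k arbitrary: p)
  case (Suc k)
  obtain e f q where p: "p = e # f # q"
    using Suc.prems(1) by (cases p; cases "tl p") auto
  have "successively (\<lambda>e f. \<not> (M e \<and> M f)) q"
    using Suc.prems(2) unfolding p by (cases q) auto
  then have "of_nat k * (d + D) \<le> (\<Sum>e\<leftarrow>q. if M e then d else D)"
    using Suc.IH[of q] Suc.prems(1) p by simp
  then show ?case
    using Suc.prems(2) \<open>d < D\<close> unfolding p by (auto simp: algebra_simps)
qed simp

text \<open>Peel off pairs from the front. As long as the first arc of a pair is cheap, the second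
  is not, and the pair costs exactly \<open>d + D\<close>. At the first expensive arc in an even
  position, what follows it has even length, so \<open>delay_even_ge\<close> applies there and that
  arc contributes the extra \<open>D\<close>.\<close>

lemma delay_odd_ge:
  fixes d D :: rat
  assumes "length p = Suc (2 * k)" "successively (\<lambda>e f. \<not> (M e \<and> M f)) p" "d < D"
  shows "(\<forall>i<length p. even i \<longrightarrow> M (p ! i)) \<or>
    of_nat k * (d + D) + D \<le> (\<Sum>e\<leftarrow>p. if M e then d else D)"
  using assms(1,2)
proof (induction k arbitrary: p)
  case 0
  then show ?case by (cases p) auto
next
  case (Suc k)
  obtain e f q where p: "p = e # f # q"
    using Suc.prems(1) by (cases p; cases "tl p") auto
  have succ: "successively (\<lambda>e f. \<not> (M e \<and> M f)) (f # q)" "successively (\<lambda>e f. \<not> (M e \<and> M f)) q"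
    using Suc.prems(2) unfolding p by (auto simp: successively_Cons)
  show ?case
  proof (cases "M e")
    case False
    have "of_nat (Suc k) * (d + D) \<le> (\<Sum>e\<leftarrow>f # q. if M e then d else D)"
      using Suc.prems(1) p by (intro delay_even_ge succ assms(3)) auto
    then show ?thesis
      using False unfolding p by auto
  next
    case True
    then have "\<not> M f" using Suc.prems(2) p by auto
    consider "\<forall>i<length q. even i \<longrightarrow> M (q ! i)"
      | "of_nat k * (d + D) + D \<le> (\<Sum>e\<leftarrow>q. if M e then d else D)"
      using Suc.IH[of q] Suc.prems(1) p succ by auto
    then show ?thesis
    proof cases
      case 1
      then show ?thesis
        using True by (auto simp: p nth_Cons split: nat.splits)
    next
      case 2
      then show ?thesis
        using True \<open>\<not> M f\<close> by (auto simp: p algebra_simps)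
    qed
  qed
qed

lemma sum_list_delay_le:
  fixes d D :: rat
  assumes "d \<le> D"
  shows "(\<Sum>e\<leftarrow>p. if M e then d else D) \<le> of_nat (length p) * D"
  using assms by (induction p) (auto simp: algebra_simps)

lemma sum_list_delay_matched_le:
  fixes d D :: rat
  assumes "length p = Suc (2 * k)" "\<forall>i<length p. even i \<longrightarrow> M (p ! i)" "d \<le> D"
  shows "(\<Sum>e\<leftarrow>p. if M e then d else D) \<le> of_nat k * (d + D) + d"
  using assms(1,2)
proof (induction k arbitrary: p)
  case 0
  then show ?case by (cases p) auto
next
  case (Suc k)
  obtain e f q where p: "p = e # f # q"
    using Suc.prems(1) by (cases p; cases "tl p") auto
  have M: "M e" "\<forall>i<length q. even i \<longrightarrow> M (q ! i)"
    using Suc.prems(2) unfolding p by force+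
  then have "(\<Sum>e\<leftarrow>q. if M e then d else D) \<le> of_nat k * (d + D) + d"
    using Suc.IH[of q] Suc.prems(1) p by simp
  then show ?case
    using M \<open>d \<le> D\<close> unfolding p by (auto simp: algebra_simps)
qed

section \<open>The approximation guarantee\<close>

locale unit_clustering =
  fixes I :: "'v clustering_instance"
  assumes problem: "clustering_problem I"
    and capacity: "capacity I = 2"
    and unit: "v \<in> pverts (network I) \<Longrightarrow> weight I v = 1"
    and no_vertex_delay: "v \<in> pverts (network I) \<Longrightarrow> vertex_delay I v = 0"
begin

abbreviation "V \<equiv> pverts (network I)"
abbreviation "E \<equiv> parcs (network I)"
abbreviation "d \<equiv> intra_delay I"
abbreviation "D \<equiv> inter_delay I"

sublocale pair_fin_digraph "network I"
  using problem unfolding clustering_problem_def by blast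

lemma acyclic: "acyclic E" and V_nonempty: "V \<noteq> {}" and delays: "0 \<le> d" "d < D"
  using problem unfolding clustering_problem_def by auto

lemma arc_in_verts: "(u, v) \<in> E \<Longrightarrow> u \<in> V \<and> v \<in> V"
  using wellformed' by blast

text \<open>A repeated vertex would close a cycle. Thus walks and paths agree, and the simple paths
  of \<open>network_delay\<close> can be handled as plain arc lists.\<close>

lemma walk_distinct:
  assumes "pcas u p v" "set p \<subseteq> E"
  shows "distinct (pawalk_verts u p)"
  using assms
proof (induction p arbitrary: u)
  case (Cons e p)
  have reach: "(x, y) \<in> E\<^sup>*" if "pcas x q z" "set q \<subseteq> E" "y \<in> set (pawalk_verts x q)" for x q y z
    using that
  proof (induction q arbitrary: x)
    case (Cons a q)
    show ?case
    proof (cases "y = x")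
      case False
      then have "(snd a, y) \<in> E\<^sup>*" using Cons by auto
      moreover have "(x, snd a) \<in> E" using Cons by auto
      ultimately show ?thesis by (rule converse_rtrancl_into_rtrancl[rotated])
    qed simp
  qed simp
  have "fst e \<notin> set (pawalk_verts (snd e) p)"
  proof
    assume "fst e \<in> set (pawalk_verts (snd e) p)"
    then have "(snd e, fst e) \<in> E\<^sup>*" using reach Cons.prems by auto
    moreover have "(fst e, snd e) \<in> E" using Cons.prems by auto
    ultimately have "(fst e, fst e) \<in> E\<^sup>+" by (rule rtrancl_into_trancl2[rotated])
    then show False using acyclic by (auto simp: acyclic_def)
  qed
  then show ?case using Cons by auto
qed simp

lemma apath_iff: "apath u p v \<longleftrightarrow> u \<in> V \<and> pcas u p v \<and> set p \<subseteq> E"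
  unfolding apath_def awalk_def using walk_distinct by auto

lemma relpow_less_card:
  assumes "E ^^ k \<noteq> {}"
  shows "k < card V"
proof (cases k)
  case 0
  then show ?thesis using V_nonempty pair_finite_verts by (simp add: card_gt_0_iff)
next
  case (Suc k')
  obtain u v where "(u, v) \<in> E ^^ k" using assms by auto
  then obtain p where p: "pcas u p v" "set p \<subseteq> E" "length p = k"
    unfolding relpow_iff_pcas by blast
  then have "u \<in> V"
    using Suc arc_in_verts by (cases p) auto
  then have "apath u p v"
    using p apath_iff by simp
  then show ?thesis
    using length_apath_less p(3) by blast
qed

definition path_ends :: "('v \<times> ('v \<times> 'v) list \<times> 'v) set" where
  "path_ends = {(u, p, v). is_source (network I) u \<and> is_sink (network I) v \<and> apath u p v}"

lemma finite_path_ends: "finite path_ends"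
proof -
  have "path_ends \<subseteq> {(u, p, v). apath u p v}"
    unfolding path_ends_def by auto
  then show ?thesis
    using apaths_finite_triple finite_subset by blast
qed

lemma path_delay_eq:
  assumes "apath u p v"
  shows "path_delay I P u p = (\<Sum>e\<leftarrow>p. arc_delay I P e)"
proof -
  have "set (pawalk_verts u p) \<subseteq> V"
    using assms awalk_verts_in_verts unfolding apath_def awalk_def by blast
  then have "map (vertex_delay I) (pawalk_verts u p) = map (\<lambda>_. 0) (pawalk_verts u p)"
    using no_vertex_delay by (intro map_cong) auto
  then have "(\<Sum>v\<leftarrow>pawalk_verts u p. vertex_delay I v) = 0"
    by (simp only: sum_list_0)
  then show ?thesis
    unfolding path_delay_def by (simp add: awalk_verts_with_proj_eq)
qed

lemma network_delay_eq:
  "network_delay I P = Max ((\<lambda>(u, p, v). \<Sum>e\<leftarrow>p. arc_delay I P e) ` path_ends)"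
proof -
  have "{path_delay I P u p | u p v. is_source (network I) u \<and> is_sink (network I) v \<and> apath u p v}
    = (\<lambda>(u, p, v). path_delay I P u p) ` path_ends"
    unfolding path_ends_def by (auto simp: image_iff) blast
  also have "\<dots> = (\<lambda>(u, p, v). \<Sum>e\<leftarrow>p. arc_delay I P e) ` path_ends"
    by (rule image_cong) (auto simp: path_ends_def path_delay_eq)
  finally show ?thesis
    unfolding network_delay_def by simp
qed

text \<open>An arc into the start or out of the end would yield a walk with \<open>L + 1\<close>
  arcs. This puts longest walks within the range of \<open>network_delay\<close>, which sees only
  paths from sources to sinks.\<close>

lemma longest_in_path_ends:
  assumes "is_longest E L" "pcas u p v" "set p \<subseteq> E" "length p = L" "u \<in> V"
  shows "(u, p, v) \<in> path_ends"
proof -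
  have path: "apath u p v"
    unfolding apath_iff using assms by blast
  have no_longer: "\<not> (pcas x q y \<and> set q \<subseteq> E \<and> length q = Suc L)" for x q y
  proof
    assume "pcas x q y \<and> set q \<subseteq> E \<and> length q = Suc L"
    then have "(x, y) \<in> E ^^ Suc L"
      unfolding relpow_iff_pcas by blast
    then have "E ^^ Suc L \<noteq> {}" by blast
    then show False
      using assms(1) Suc_n_not_le_n unfolding is_longest_def by blast
  qed
  have "is_source (network I) u"
  proof -
    have "(x, u) \<notin> E" for x
      using no_longer[of x "(x, u) # p" v] assms by auto
    then have "in_arcs (network I) u = {}"
      by (auto simp: in_arcs_def)
    then show ?thesis
      unfolding is_source_def in_degree_def using assms by simp
  qed
  moreover have "is_sink (network I) v"
  proof -
    have "(v, x) \<notin> E" for x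
    proof
      assume "(v, x) \<in> E"
      moreover have "pcas u (p @ [(v, x)]) x"
        unfolding pcas_append using assms(2) by (intro exI[of _ v]) simp
      ultimately show False
        using no_longer[of u "p @ [(v, x)]" x] assms(3,4) by simp
    qed
    then have "out_arcs (network I) v = {}"
      by (auto simp: out_arcs_def)
    moreover have "v \<in> V"
      using path awalk_last_in_verts unfolding apath_def by blast
    ultimately show ?thesis
      unfolding is_sink_def out_degree_def by simp
  qed
  ultimately show ?thesis
    unfolding path_ends_def using path by simp
qed

lemma ex_longest_path:
  assumes "is_longest E L"
  shows "\<exists>u p v. u \<in> V \<and> pcas u p v \<and> set p \<subseteq> E \<and> length p = L"
proof (cases L)
  \<comment> \<open>\<open>E ^^ 0\<close> is the identity on the whole type, so its elements need
    not be vertices; the empty walk is placed at a vertex by hand.\<close>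
  case 0
  then show ?thesis using V_nonempty by fastforce
next
  case (Suc k)
  obtain u v where "(u, v) \<in> E ^^ L"
    using assms unfolding is_longest_def by auto
  then obtain p where p: "pcas u p v" "set p \<subseteq> E" "length p = L"
    unfolding relpow_iff_pcas by blast
  then have "u \<in> V"
    using Suc arc_in_verts by (cases p) auto
  then show ?thesis using p by blast
qed

section \<open>Clusters of at most two vertices\<close>

lemma sum_weight_eq_card:
  assumes "C \<subseteq> V"
  shows "sum (weight I) C = of_nat (card C)"
  using unit assms by (subst sum.cong[of C C _ "\<lambda>_. 1"]) auto

lemma feasible_card:
  assumes "feasible_clustering I P" "C \<in> P"
  shows "finite C" "card C \<le> 2"
proof -
  have "C \<subseteq> V"
    using assms unfolding feasible_clustering_def partition_on_def by blast
  then show "finite C" using pair_finite_verts by (rule finite_subset)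
  have "(of_nat (card C) :: rat) \<le> of_nat 2"
    using sum_weight_eq_card[OF \<open>C \<subseteq> V\<close>] assms capacity unfolding feasible_clustering_def by auto
  then show "card C \<le> 2"
    using of_nat_le_iff by blast
qed

definition together :: "'v set set \<Rightarrow> 'v \<times> 'v \<Rightarrow> bool" where
  "together P e \<longleftrightarrow> (\<exists>C\<in>P. fst e \<in> C \<and> snd e \<in> C)"

lemma arc_delay_eq: "arc_delay I P e = (if together P e then d else D)"
  unfolding arc_delay_def together_def by simp

text \<open>A cluster holding two distinct vertices consists of just these, and disjoint clusters
  that share a vertex coincide.\<close>

lemma together_common_vertex:
  assumes P: "feasible_clustering I P" and "together P (u, v)" "together P (u', v')"
    and ne: "u \<noteq> v" "u' \<noteq> v'" and common: "{u, v} \<inter> {u', v'} \<noteq> {}"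
  shows "{u, v} = {u', v'}"
proof -
  obtain C where C: "C \<in> P" "{u, v} \<subseteq> C"
    using assms(2) unfolding together_def by auto
  obtain C' where C': "C' \<in> P" "{u', v'} \<subseteq> C'"
    using assms(3) unfolding together_def by auto
  have "C \<inter> C' \<noteq> {}"
    using common C(2) C'(2) by blast
  moreover have "disjoint P"
    using P unfolding feasible_clustering_def partition_on_def by simp
  ultimately have "C' = C"
    using disjointD[OF _ C(1) C'(1)] by blast
  have "{u, v} = C"
    using feasible_card[OF P \<open>C \<in> P\<close>] C(2) ne(1) by (intro card_seteq) auto
  moreover have "{u', v'} = C"
    using feasible_card[OF P \<open>C \<in> P\<close>] C'(2) ne(2) \<open>C' = C\<close> by (intro card_seteq) auto
  ultimately show ?thesis by simp
qed

lemma arc_neq: "(u, v) \<in> E \<Longrightarrow> u \<noteq> v"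
  using acyclic unfolding acyclic_def by blast

text \<open>Consecutive arcs share a vertex; if both lay in clusters, they would have the same two
  ends and form a cycle of length two.\<close>

lemma walk_not_both_together:
  assumes P: "feasible_clustering I P" and "pcas u p v" "set p \<subseteq> E"
  shows "successively (\<lambda>e f. \<not> (together P e \<and> together P f)) p"
  using assms(2,3)
proof (induction p arbitrary: u)
  case (Cons e p)
  have "\<not> (together P e \<and> together P f)" if "p = f # q" for f q
  proof
    assume *: "together P e \<and> together P f"
    define x y z where "x = fst e" and "y = snd e" and "z = snd f"
    then have ef: "e = (x, y)" "f = (y, z)"
      using Cons.prems that by (simp_all add: prod_eq_iff)
    then have E: "(x, y) \<in> E" "(y, z) \<in> E" using Cons.prems that by simp_all
    then have ne: "x \<noteq> y" "y \<noteq> z" by (simp_all add: arc_neq)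
    then have "{x, y} = {y, z}"
      using * ef by (intro together_common_vertex[OF P]) simp_all
    then have "x = z" using ne by (simp add: doubleton_eq_iff)
    then have "(x, x) \<in> E\<^sup>+" using E by (blast intro: trancl_into_trancl)
    then show False using acyclic by (simp add: acyclic_def)
  qed
  moreover have "successively (\<lambda>e f. \<not> (together P e \<and> together P f)) p"
    using Cons.IH[of "snd e"] Cons.prems by simp
  ultimately show ?case
    by (cases p) simp_all
qed simp

text \<open>The assumption \<open>greedy\<close> asks for the critical arcs only if they form a
  matching, which is exactly what a greedy procedure can promise without knowing the
  optimum.\<close>

theorem two_approximation:
  assumes L: "is_longest E L" and P: "feasible_clustering I P"
    and greedy: "(\<And>u v u' v'. (u, v) \<in> critical_arcs E L \<Longrightarrow> (u', v') \<in> critical_arcs E L \<Longrightarrow>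
        {u, v} \<inter> {u', v'} \<noteq> {} \<Longrightarrow> {u, v} = {u', v'}) \<Longrightarrow>
      (\<And>e. e \<in> critical_arcs E L \<Longrightarrow> together P e)"
  shows "network_delay I P \<le> 2 * optimal_delay I"
proof -
  let ?cost = "\<lambda>P p. \<Sum>e\<leftarrow>p. arc_delay I P e"
  have length_le: "length p \<le> L" if "(u, p, v) \<in> path_ends" for u p v
  proof -
    have "pcas u p v" "set p \<subseteq> E"
      using that by (auto simp: path_ends_def apath_iff)
    then have "(u, v) \<in> E ^^ length p"
      unfolding relpow_iff_pcas by blast
    then show ?thesis
      using L unfolding is_longest_def by blast
  qed
  have ne: "path_ends \<noteq> {}"
    using ex_longest_path[OF L] longest_in_path_ends[OF L] by blast
  have D: "0 \<le> D" using delays by simp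
  have approx: "network_delay I P \<le> 2 * network_delay I P'" if P': "feasible_clustering I P'" for P'
  proof -
    have nd_ge: "?cost P' p \<le> network_delay I P'" if "(u, p, v) \<in> path_ends" for u p v
      unfolding network_delay_eq using that finite_path_ends by (intro Max_ge) force+
    have trivial: "?cost P p \<le> of_nat L * D" if "(u, p, v) \<in> path_ends" for u p v
    proof -
      have "?cost P p \<le> of_nat (length p) * D"
        unfolding arc_delay_eq by (rule sum_list_delay_le) (use delays in simp)
      also have "\<dots> \<le> of_nat L * D"
        using length_le[OF that] D by (intro mult_right_mono) auto
      finally show ?thesis .
    qed
    have "?cost P p \<le> 2 * network_delay I P'" if p: "(u, p, v) \<in> path_ends" for u p v
    proof -
      \<comment> \<open>With \<open>L > 0\<close> the walk has a first arc, which forces its start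
        to be a vertex.\<close>
      have long: "(x, q, y) \<in> path_ends" if "pcas x q y" "set q \<subseteq> E" "length q = L" "L > 0" for x q y
      proof -
        have "x \<in> V" using that arc_in_verts by (cases q) auto
        then show ?thesis using that longest_in_path_ends[OF L] by blast
      qed
      consider (even) k where "L = 2 * k"
        | (odd_far) k x q y where "L = Suc (2 * k)" "(x, q, y) \<in> path_ends" "length q = L"
            "of_nat k * (d + D) + D \<le> ?cost P' q"
        | (odd_near) k where "L = Suc (2 * k)"
            "\<And>x q y i. \<lbrakk>(x, q, y) \<in> path_ends; length q = L; i < L; even i\<rbrakk> \<Longrightarrow> together P' (q ! i)"
      proof (cases "even L")
        case True
        then show thesis using even by (auto elim: evenE)
      next
        case False
        then obtain k where k: "L = Suc (2 * k)" by (auto elim: oddE)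
        have "(\<forall>i<length q. even i \<longrightarrow> together P' (q ! i)) \<or>
          of_nat k * (d + D) + D \<le> ?cost P' q" if "(x, q, y) \<in> path_ends" "length q = L" for x q y
          unfolding arc_delay_eq using that k delays
          by (intro delay_odd_ge walk_not_both_together[OF P'])
            (auto simp: path_ends_def apath_iff)
        then show thesis
          using odd_far odd_near k by metis
      qed
      then show ?thesis
      proof cases
        case even
        obtain x q y where q: "x \<in> V" "pcas x q y" "set q \<subseteq> E" "length q = L"
          using ex_longest_path[OF L] by blast
        then have "of_nat k * (d + D) \<le> ?cost P' q"
          unfolding arc_delay_eq using even delays
          by (intro delay_even_ge walk_not_both_together[OF P']) auto
        also have "\<dots> \<le> network_delay I P'"
          using nd_ge longest_in_path_ends[OF L] q by blast
        finally have "of_nat k * (d + D) \<le> network_delay I P'" .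
        \<comment> \<open>Here the factor 2 arises: dropping \<open>d\<close> leaves
          \<open>k D\<close>, half of the trivial upper bound \<open>2 k D\<close>.\<close>
        moreover have "of_nat k * D \<le> of_nat k * (d + D)"
          using delays(1) by (intro mult_left_mono) auto
        ultimately have "of_nat k * D \<le> network_delay I P'"
          by (rule order_trans[rotated])
        then show ?thesis
          using trivial[OF p] even by auto
      next
        case odd_far
        have "of_nat k * D + D \<le> of_nat k * (d + D) + D"
          using delays(1) by (auto simp: algebra_simps)
        then have "of_nat k * D + D \<le> network_delay I P'"
          using odd_far(4) nd_ge[OF odd_far(2)] by linarith
        then show ?thesis
          using trivial[OF p] odd_far(1) D by (auto simp: algebra_simps)
      next
        case odd_near
        have crit: "together P' e" if e: "e \<in> critical_arcs E L" for e
        proof -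
          obtain x q y i where q: "pcas x q y" "set q \<subseteq> E" "length q = L"
            and i: "i < L" "even i" "q ! i = e"
            using e by (rule critical_arcsE)
          have "(x, q, y) \<in> path_ends"
            using long[OF q] i(1) by simp
          then show ?thesis
            using odd_near(2)[OF _ q(3) i(1,2)] i(3) by simp
        qed
        \<comment> \<open>That \<open>P'\<close> joins the ends of all critical arcs certifies that
          they form a matching, so the premise of \<open>greedy\<close> can be discharged.\<close>
        have near: "together P e" if "e \<in> critical_arcs E L" for e
        proof (rule greedy[OF _ that])
          fix u v u' v'
          assume "(u, v) \<in> critical_arcs E L" "(u', v') \<in> critical_arcs E L" "{u, v} \<inter> {u', v'} \<noteq> {}"
          then show "{u, v} = {u', v'}"
            using crit arc_neq by (intro together_common_vertex[OF P']) (auto simp: critical_arcs_def)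
        qed
        obtain x q y where q: "x \<in> V" "pcas x q y" "set q \<subseteq> E" "length q = L"
          using ex_longest_path[OF L] by blast
        \<comment> \<open>The first arc costs at least \<open>d\<close>; the remaining
          \<open>2 k\<close> arcs are bounded in pairs.\<close>
        have "of_nat k * (d + D) + d \<le> ?cost P' q"
        proof -
          obtain e r where er: "q = e # r" using q odd_near(1) by (cases q) auto
          have r: "pcas (snd e) r y" "set r \<subseteq> E" "length r = 2 * k"
            using q er odd_near(1) by auto
          have "of_nat k * (d + D) \<le> ?cost P' r"
            unfolding arc_delay_eq using r delays
            by (intro delay_even_ge walk_not_both_together[OF P']) auto
          then show ?thesis
            using er delays by (auto simp: arc_delay_eq)
        qed
        then have ge: "of_nat k * (d + D) + d \<le> network_delay I P'"
          using nd_ge[OF longest_in_path_ends[OF L q(2-4,1)]] by (rule order_trans)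
        show ?thesis
        proof (cases "length p = L")
          case True
          then have "?cost P p \<le> of_nat k * (d + D) + d"
            unfolding arc_delay_eq using odd_near(1) p delays
            by (intro sum_list_delay_matched_le)
              (use nth_in_critical_arcs[of u p v E] True in \<open>auto simp: path_ends_def apath_iff intro!: near\<close>)
          moreover have "0 \<le> of_nat k * (d + D) + d"
            using delays by auto
          ultimately show ?thesis using ge by linarith
        next
          \<comment> \<open>One arc less than \<open>L = 2 k + 1\<close> makes the trivial bound
            \<open>2 k D\<close>, which is again within twice \<open>k D\<close>.\<close>
          case False
          then have "length p \<le> 2 * k"
            using length_le[OF p] odd_near(1) by simp
          then have "of_nat (length p) * D \<le> of_nat (2 * k) * D"
            using D by (intro mult_right_mono) (auto simp flip: of_nat_mult simp del: of_nat_mult)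
          moreover have "?cost P p \<le> of_nat (length p) * D"
            unfolding arc_delay_eq by (rule sum_list_delay_le) (use delays in simp)
          moreover have "of_nat k * D \<le> of_nat k * (d + D) + d"
            using delays by (auto simp: algebra_simps)
          ultimately show ?thesis using ge by auto
        qed
      qed
    qed
    then show ?thesis
      unfolding network_delay_eq[of P] using finite_path_ends ne by (intro Max.boundedI) auto
  qed
  have "finite {P. feasible_clustering I P}"
    using finitely_many_partition_on[OF pair_finite_verts] unfolding feasible_clustering_def
    by (rule rev_finite_subset) auto
  then have "\<exists>P'. feasible_clustering I P' \<and> optimal_delay I = network_delay I P'"
    unfolding optimal_delay_def using Min_in[of "network_delay I ` {P. feasible_clustering I P}"] P
    by blast
  then show ?thesis using approx by auto
qed

end

section \<open>Programs with bounded loops\<close>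

lemma bit_length_le_iff: "bit_length n \<le> w \<longleftrightarrow> 1 \<le> w \<and> n < 2 ^ w"
  unfolding bit_length_def by (auto simp: floorlog_le_iff)

lemma bit_length_pos: "1 \<le> bit_length n"
  by (simp add: bit_length_def)

lemma bit_length_add_le: "bit_length (m + n) \<le> Suc (max (bit_length m) (bit_length n))"
proof -
  let ?w = "max (bit_length m) (bit_length n)"
  have "m < 2 ^ ?w" "n < 2 ^ ?w"
    by (rule bit_length_le_iff[THEN iffD1, THEN conjunct2], simp)+
  then have "m + n < 2 ^ Suc ?w" by simp
  then show ?thesis by (simp add: bit_length_le_iff)
qed

lemma bit_length_mono: "m \<le> n \<Longrightarrow> bit_length m \<le> bit_length n"
  unfolding bit_length_def by (simp add: floorlog_mono max.coboundedI2)

definition wide :: "nat \<Rightarrow> ram_state \<Rightarrow> bool" where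
  "wide w s \<longleftrightarrow> (\<forall>r. bit_length (fst s r) \<le> w) \<and> (\<forall>a. bit_length (snd s a) \<le> w)"

text \<open>One number with two uses: it bounds the digits by which a value can exceed the width
  \<open>w\<close>, and it is the factor in front of \<open>w + exp_size e\<close> in the bound for
  the cost.\<close>

fun exp_size :: "ram_exp \<Rightarrow> nat" where
  "exp_size (Const c) = bit_length c"
| "exp_size (Reg r) = Suc (bit_length r)"
| "exp_size (Mem a) = Suc (exp_size a)"
| "exp_size (Add a b) = Suc (exp_size a + exp_size b)"
| "exp_size (Sub a b) = Suc (exp_size a + exp_size b)"

lemma bit_length_exp_val:
  assumes "wide w s"
  shows "bit_length (exp_val e s) \<le> w + exp_size e"
proof (induction e)
  case (Add a b)
  then show ?case
    using bit_length_add_le[of "exp_val a s" "exp_val b s"] by auto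
next
  case (Sub a b)
  then show ?case
    using bit_length_mono[of "exp_val a s - exp_val b s" "exp_val a s"] by auto
next
  case (Reg r)
  then show ?case using assms by (simp add: wide_def add_increasing2 le_SucI trans_le_add1)
next
  case (Mem e)
  then show ?case using assms by (simp add: wide_def le_SucI trans_le_add1)
qed simp

lemma exp_cost_le:
  assumes "wide w s"
  shows "exp_cost e s \<le> exp_size e * (w + exp_size e)"
proof (induction e)
  case (Const c)
  then show ?case using bit_length_pos[of c] by (simp add: add_increasing)
next
  case (Reg r)
  have "bit_length (fst s r) \<le> w" using assms by (simp add: wide_def)
  then show ?case by (simp add: algebra_simps)
next
  case (Mem e)
  have "bit_length (snd s (exp_val e s)) \<le> w" using assms by (simp add: wide_def)
  then show ?case using Mem by (simp add: algebra_simps)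
next
  case (Add a b)
  have "bit_length (exp_val (Add a b) s) \<le> w + exp_size (Add a b)"
    by (rule bit_length_exp_val[OF assms])
  then show ?case using Add by (simp add: algebra_simps)
next
  case (Sub a b)
  have "bit_length (exp_val (Sub a b) s) \<le> w + exp_size (Sub a b)"
    by (rule bit_length_exp_val[OF assms])
  then show ?case using Sub by (simp add: algebra_simps)
qed

text \<open>Every step lengthens the numbers in use by a bounded number of digits, because the machine
  only adds and subtracts. Hence logarithmic cost is at most quadratic in the number \<open>k\<close> of steps,
  each weighted by the size of its expressions.\<close>

definition runs :: "ram_prog \<Rightarrow> ram_state \<Rightarrow> nat \<Rightarrow> (ram_state \<Rightarrow> bool) \<Rightarrow> bool" where
  "runs c s k Q \<longleftrightarrow> (\<exists>t s'. ram_exec c s t s' \<and> Q s' \<and>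
     (\<forall>w. wide w s \<longrightarrow> t \<le> k * (w + k) \<and> wide (w + k) s'))"

lemma runs_mono:
  assumes "runs c s k Q" "k \<le> k'" "\<And>s'. Q s' \<Longrightarrow> Q' s'"
  shows "runs c s k' Q'"
proof -
  obtain t s' where e: "ram_exec c s t s'" "Q s'"
    and w: "\<And>w. wide w s \<Longrightarrow> t \<le> k * (w + k) \<and> wide (w + k) s'"
    using assms(1) unfolding runs_def by blast
  have "t \<le> k' * (w + k') \<and> wide (w + k') s'" if "wide w s" for w
  proof
    have "k * (w + k) \<le> k' * (w + k')"
      using assms(2) by (intro mult_mono) auto
    then show "t \<le> k' * (w + k')" using w[OF that] by simp
    show "wide (w + k') s'" using w[OF that] assms(2) unfolding wide_def
      by (meson add_left_mono order_trans)
  qed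
  then show ?thesis using e assms(3) unfolding runs_def by blast
qed

lemma runs_Skip: "Q s \<Longrightarrow> runs Skip s 1 Q"
  unfolding runs_def
  by (intro exI[of _ 1] exI[of _ s]) (use exec_Skip[of s] in \<open>auto simp: wide_def intro: le_SucI\<close>)

lemma runs_Set_Reg:
  assumes "Q ((fst s)(r := exp_val a s), snd s)"
  shows "runs (Set_Reg r a) s (bit_length r + exp_size a) Q"
  unfolding runs_def
proof (intro exI conjI allI impI)
  show "ram_exec (Set_Reg r a) s (bit_length r + exp_cost a s) ((fst s)(r := exp_val a s), snd s)"
    by (rule exec_Set_Reg)
  fix w assume w: "wide w s"
  have "bit_length r * 1 \<le> bit_length r * (w + (bit_length r + exp_size a))"
    using bit_length_pos[of r] by (intro mult_left_mono) auto
  then show "bit_length r + exp_cost a s \<le> (bit_length r + exp_size a) * (w + (bit_length r + exp_size a))"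
    using exp_cost_le[OF w, of a] by (simp add: algebra_simps)
  show "wide (w + (bit_length r + exp_size a)) ((fst s)(r := exp_val a s), snd s)"
    using w bit_length_exp_val[OF w, of a] by (auto simp: wide_def intro: trans_le_add1)
qed (rule assms)

lemma runs_Set_Mem:
  assumes "Q (fst s, (snd s)(exp_val a s := exp_val b s))"
  shows "runs (Set_Mem a b) s (exp_size a + exp_size b) Q"
  unfolding runs_def
proof (intro exI conjI allI impI)
  show "ram_exec (Set_Mem a b) s (exp_cost a s + exp_cost b s)
       (fst s, (snd s)(exp_val a s := exp_val b s))"
    by (rule exec_Set_Mem)
  fix w assume w: "wide w s"
  show "exp_cost a s + exp_cost b s \<le> (exp_size a + exp_size b) * (w + (exp_size a + exp_size b))"
    using exp_cost_le[OF w, of a] exp_cost_le[OF w, of b] by (simp add: algebra_simps)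
  show "wide (w + (exp_size a + exp_size b)) (fst s, (snd s)(exp_val a s := exp_val b s))"
    using w bit_length_exp_val[OF w, of b] by (auto simp: wide_def intro: trans_le_add1)
qed (rule assms)

text \<open>The second program starts at width \<open>w + k1\<close>, and
  \<open>k1 * (w + k1) + k2 * (w + k1 + k2)\<close> is at most
  \<open>(k1 + k2) * (w + k1 + k2)\<close>. So the form of the bound survives composition, and step
  counts simply add.\<close>

lemma runs_Seq:
  assumes "runs c1 s k1 (\<lambda>s'. runs c2 s' k2 Q)"
  shows "runs (Seq c1 c2) s (k1 + k2) Q"
proof -
  obtain t1 s1 where 1: "ram_exec c1 s t1 s1" "runs c2 s1 k2 Q"
    and w1: "\<And>w. wide w s \<Longrightarrow> t1 \<le> k1 * (w + k1) \<and> wide (w + k1) s1"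
    using assms unfolding runs_def[of c1] by blast
  obtain t2 s2 where 2: "ram_exec c2 s1 t2 s2" "Q s2"
    and w2: "\<And>w. wide w s1 \<Longrightarrow> t2 \<le> k2 * (w + k2) \<and> wide (w + k2) s2"
    using 1(2) unfolding runs_def by blast
  have "t1 + t2 \<le> (k1 + k2) * (w + (k1 + k2)) \<and> wide (w + (k1 + k2)) s2" if "wide w s" for w
    using w1[OF that] w2[of "w + k1"] by (auto simp: algebra_simps)
  then show ?thesis
    unfolding runs_def using exec_Seq[OF 1(1) 2(1)] 2(2) by blast
qed

lemma cond_cost_le:
  assumes "wide w s"
  shows "cond_cost (Less a b) s \<le> (exp_size a + exp_size b) * (w + (exp_size a + exp_size b))"
  using exp_cost_le[OF assms, of a] exp_cost_le[OF assms, of b] by (simp add: algebra_simps)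

text \<open>A test costs time but leaves the state alone; branching and loop steps share this
  accounting.\<close>

lemma runs_after_cond:
  assumes "runs c s k Q" and "\<And>t s'. ram_exec c s t s' \<Longrightarrow> ram_exec c' s (cond_cost (Less a b) s + t) s'"
  shows "runs c' s (exp_size a + exp_size b + k) Q"
proof -
  obtain t s' where e: "ram_exec c s t s'" "Q s'"
    and w: "\<And>w. wide w s \<Longrightarrow> t \<le> k * (w + k) \<and> wide (w + k) s'"
    using assms unfolding runs_def by blast
  let ?g = "exp_size a + exp_size b"
  have "cond_cost (Less a b) s + t \<le> (?g + k) * (w + (?g + k)) \<and> wide (w + (?g + k)) s'"
    if "wide w s" for w
  proof
    show "cond_cost (Less a b) s + t \<le> (?g + k) * (w + (?g + k))"
      using w[OF that] cond_cost_le[OF that, of a b] by (simp add: algebra_simps)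
    show "wide (w + (?g + k)) s'"
      using w[OF that] unfolding wide_def by (auto intro: order_trans)
  qed
  then show ?thesis
    unfolding runs_def using assms(2)[OF e(1)] e(2) by blast
qed

lemma runs_Ite:
  assumes "exp_val a s < exp_val b s \<Longrightarrow> runs c1 s k Q"
    and "\<not> exp_val a s < exp_val b s \<Longrightarrow> runs c2 s k Q"
  shows "runs (Ite (Less a b) c1 c2) s (exp_size a + exp_size b + k) Q"
proof (cases "exp_val a s < exp_val b s")
  case True
  show ?thesis
    by (rule runs_after_cond[OF assms(1)[OF True]], rule exec_Ite_True) (use True in auto)
next
  case False
  show ?thesis
    by (rule runs_after_cond[OF assms(2)[OF False]], rule exec_Ite_False) (use False in auto)
qed

lemma runs_While_False:
  assumes "\<not> exp_val a s < exp_val b s" "Q s"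
  shows "runs (While (Less a b) c) s (exp_size a + exp_size b) Q"
  unfolding runs_def
proof (intro exI conjI allI impI)
  show "ram_exec (While (Less a b) c) s (cond_cost (Less a b) s) s"
    using assms by (intro exec_While_False) simp
  fix w assume w: "wide w s"
  show "cond_cost (Less a b) s \<le> (exp_size a + exp_size b) * (w + (exp_size a + exp_size b))"
    by (rule cond_cost_le[OF w])
  show "wide (w + (exp_size a + exp_size b)) s"
    using w unfolding wide_def by (auto intro: trans_le_add1)
qed (rule assms)

lemma runs_While_True:
  assumes "exp_val a s < exp_val b s" "runs c s k1 (\<lambda>s'. runs (While (Less a b) c) s' k2 Q)"
  shows "runs (While (Less a b) c) s (exp_size a + exp_size b + (k1 + k2)) Q"
proof (rule runs_after_cond[OF runs_Seq[OF assms(2)]])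
  fix t s' assume "ram_exec (Seq c (While (Less a b) c)) s t s'"
  then obtain t1 t2 s1 where "ram_exec c s t1 s1" "ram_exec (While (Less a b) c) s1 t2 s'" "t = t1 + t2"
    by (auto elim: ram_exec.cases)
  then show "ram_exec (While (Less a b) c) s (cond_cost (Less a b) s + t) s'"
    using exec_While_True[of "Less a b" s c t1 s1 t2 s'] assms(1) by (simp add: add.assoc)
qed

section \<open>Loop-free programs\<close>

fun straight :: "ram_prog \<Rightarrow> bool" where
  "straight Skip = True"
| "straight (Set_Reg r a) = True"
| "straight (Set_Mem a b) = True"
| "straight (Seq c1 c2) \<longleftrightarrow> straight c1 \<and> straight c2"
| "straight (Ite b c1 c2) \<longleftrightarrow> straight c1 \<and> straight c2"
| "straight (While b c) = False"

fun effect :: "ram_prog \<Rightarrow> ram_state \<Rightarrow> ram_state" where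
  "effect Skip s = s"
| "effect (Set_Reg r a) s = ((fst s)(r := exp_val a s), snd s)"
| "effect (Set_Mem a b) s = (fst s, (snd s)(exp_val a s := exp_val b s))"
| "effect (Seq c1 c2) s = effect c2 (effect c1 s)"
| "effect (Ite b c1 c2) s = (if cond_val b s then effect c1 s else effect c2 s)"
| "effect (While b c) s = s"

text \<open>Both branches of \<open>Ite\<close> are counted, so the size does not depend on the
  state and one constant serves all passes of a loop.\<close>

fun prog_size :: "ram_prog \<Rightarrow> nat" where
  "prog_size Skip = 1"
| "prog_size (Set_Reg r a) = bit_length r + exp_size a"
| "prog_size (Set_Mem a b) = exp_size a + exp_size b"
| "prog_size (Seq c1 c2) = prog_size c1 + prog_size c2"
| "prog_size (Ite b c1 c2) = (case b of Less x y \<Rightarrow> exp_size x + exp_size y) + (prog_size c1 + prog_size c2)"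
| "prog_size (While b c) = 0"

lemma runs_straight:
  assumes "straight c" "Q (effect c s)"
  shows "runs c s (prog_size c) Q"
  using assms
proof (induction c arbitrary: s Q)
  case Skip
  then show ?case using runs_Skip by simp
next
  case (Set_Reg r a)
  then show ?case using runs_Set_Reg by simp
next
  case (Set_Mem a b)
  then show ?case using runs_Set_Mem by simp
next
  case (Seq c1 c2)
  have "runs c1 s (prog_size c1) (\<lambda>s'. runs c2 s' (prog_size c2) Q)"
    using Seq.prems by (intro Seq.IH) auto
  then show ?case by (simp add: runs_Seq)
next
  case (Ite g c1 c2)
  obtain a b where g: "g = Less a b" by (cases g)
  have "runs (Ite (Less a b) c1 c2) s (exp_size a + exp_size b + (prog_size c1 + prog_size c2)) Q"
  proof (rule runs_Ite)
    assume "exp_val a s < exp_val b s"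
    then show "runs c1 s (prog_size c1 + prog_size c2) Q"
      using Ite.prems g by (intro runs_mono[OF Ite.IH(1)[of Q s]]) auto
  next
    assume "\<not> exp_val a s < exp_val b s"
    then show "runs c2 s (prog_size c1 + prog_size c2) Q"
      using Ite.prems g by (intro runs_mono[OF Ite.IH(2)[of Q s]]) auto
  qed
  then show ?case using g by simp
qed simp

text \<open>By convention register 1 holds the number of vertices, the bound of all loops.\<close>

definition For :: "nat \<Rightarrow> ram_prog \<Rightarrow> ram_prog" where
  "For i body = Seq (Set_Reg i (Const 0))
     (While (Less (Reg i) (Reg 1)) (Seq body (Set_Reg i (Add (Reg i) (Const 1)))))"

text \<open>Charged \<open>n + 1\<close> times: a test and an increment for each of the
  \<open>n\<close> passes, while the extra share pays for the initial assignment and the final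
  failing test.\<close>

definition for_size :: "nat \<Rightarrow> nat" where
  "for_size i = bit_length i + exp_size (Const 0) + (exp_size (Reg i) + exp_size (Reg 1)) +
     (bit_length i + exp_size (Add (Reg i) (Const 1)))"

text \<open>\<open>J j\<close> is meant for the moment when the counter has just become
  \<open>j\<close>; hence \<open>step\<close> establishes \<open>J (Suc j)\<close> after the
  increment that follows the body. The induction is on the number \<open>m\<close> of remaining
  passes.\<close>

lemma runs_For:
  assumes "i \<noteq> 1"
    and bound: "\<And>j s. J j s \<Longrightarrow> fst s 1 = n"
    and init: "J 0 ((fst s)(i := 0), snd s)"
    and step: "\<And>j s. \<lbrakk>j < n; J j s; fst s i = j\<rbrakk> \<Longrightarrow>
      runs body s k (\<lambda>s'. fst s' i = j \<and> J (Suc j) ((fst s')(i := Suc j), snd s'))"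
    and post: "\<And>s. J n s \<Longrightarrow> Q s"
  shows "runs (For i body) s (Suc n * (k + for_size i)) Q"
proof -
  let ?inc = "Set_Reg i (Add (Reg i) (Const 1))"
  let ?loop = "While (Less (Reg i) (Reg 1)) (Seq body ?inc)"
  let ?g = "exp_size (Reg i) + exp_size (Reg 1)"
  let ?p = "bit_length i + exp_size (Add (Reg i) (Const 1))"
  have loop: "runs ?loop s (m * (?g + k + ?p) + ?g) Q"
    if "J j s" "fst s i = j" "j + m = n" for m j s
    using that
  proof (induction m arbitrary: j s)
    case 0
    then have "runs ?loop s ?g Q"
      using bound[of j s] post by (intro runs_While_False) auto
    then show ?case by simp
  next
    case (Suc m)
    have "runs (Seq body ?inc) s (k + ?p) (\<lambda>s'. runs ?loop s' (m * (?g + k + ?p) + ?g) Q)"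
    proof (rule runs_Seq, rule runs_mono[OF step[of j s]])
      fix s' assume s': "fst s' i = j \<and> J (Suc j) ((fst s')(i := Suc j), snd s')"
      then have "runs ?loop ((fst s')(i := Suc j), snd s') (m * (?g + k + ?p) + ?g) Q"
        using Suc by (intro Suc.IH) auto
      then show "runs ?inc s' ?p (\<lambda>s'. runs ?loop s' (m * (?g + k + ?p) + ?g) Q)"
        using s' by (intro runs_Set_Reg) simp
    qed (use Suc in auto)
    then have "runs ?loop s (?g + (k + ?p + (m * (?g + k + ?p) + ?g))) Q"
      using Suc.prems bound[of j s] by (intro runs_While_True) auto
    then show ?case
      by (rule runs_mono) (auto simp: algebra_simps)
  qed
  have "runs (For i body) s (bit_length i + exp_size (Const 0) + (n * (?g + k + ?p) + ?g)) Q"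
    unfolding For_def using init
    by (intro runs_Seq runs_Set_Reg loop[of 0]) auto
  then show ?thesis
    by (rule runs_mono) (auto simp: for_size_def algebra_simps)
qed

section \<open>Loops over all pairs of vertices\<close>

text \<open>Register 5 holds the address of row \<open>u\<close> of the adjacency matrix, registers 6 and 7 hold the
  vertices \<open>u\<close> and \<open>v\<close>.\<close>

definition row_start :: ram_exp where
  "row_start = Add (Const 7) (Add (Add (Reg 1) (Reg 1)) (Add (Reg 1) (Reg 1)))"

text \<open>Without multiplication, \<open>u * n\<close> is obtained by adding \<open>n\<close> to
  register 5 after each row. The matrix starts at \<open>7 + 4 * n\<close>: one cell for
  \<open>n\<close>, two for each of three rationals, and two for each of the \<open>2 * n\<close>
  weights and vertex delays.\<close>

definition For_Pairs :: "ram_prog \<Rightarrow> ram_prog" where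
  "For_Pairs body =
     Seq (Set_Reg 5 row_start)
       (For 6 (Seq (For 7 body) (Set_Reg 5 (Add (Reg 5) (Reg 1)))))"

definition pairs_size :: "nat \<Rightarrow> nat \<Rightarrow> nat" where
  "pairs_size n k = bit_length 5 + exp_size row_start +
     Suc n * (Suc n * (k + for_size 7) + (bit_length 5 + exp_size (Add (Reg 5) (Reg 1))) + for_size 6)"

text \<open>The invariant is indexed by the set of pairs already treated, so its users never see the
  nested counters; \<open>loop_reg\<close> reserves registers 5, 6 and 7 for the loops.\<close>

lemma runs_For_Pairs:
  assumes straight: "straight body"
    and loop_reg: "\<And>S regs mem i x. \<lbrakk>i \<in> {5, 6, 7}; J S (regs, mem)\<rbrakk> \<Longrightarrow> J S (regs(i := x), mem)"
    and bound: "\<And>S s. J S s \<Longrightarrow> fst s 1 = n"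
    and init: "J {} s"
    and step: "\<And>S s u v. \<lbrakk>u < n; v < n; J S s; fst s 5 = 7 + 4 * n + u * n; fst s 6 = u; fst s 7 = v\<rbrakk> \<Longrightarrow>
      J (insert (u, v) S) (effect body s) \<and> (\<forall>i\<in>{5, 6, 7}. fst (effect body s) i = fst s i)"
    and post: "\<And>s. J ({..<n} \<times> {..<n}) s \<Longrightarrow> Q s"
  shows "runs (For_Pairs body) s (pairs_size n (prog_size body)) Q"
proof -
  let ?row = "\<lambda>u. 7 + 4 * n + u * n"
  let ?next = "Set_Reg 5 (Add (Reg 5) (Reg 1))"
  let ?Jo = "\<lambda>u s. J ({..<u} \<times> {..<n}) s \<and> fst s 5 = ?row u"
  let ?Ji = "\<lambda>u v s. J ({..<u} \<times> {..<n} \<union> {u} \<times> {..<v}) s \<and> fst s 5 = ?row u \<and> fst s 6 = u"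
  have loop_reg': "J S ((fst s)(i := x), snd s)" if "i \<in> {5, 6, 7}" "J S s" for S s i x
    using loop_reg[of i S "fst s" "snd s"] that by simp
  have inner: "runs (For 7 body) s (Suc n * (prog_size body + for_size 7)) (?Ji u n)"
    if "u < n" "?Jo u s" "fst s 6 = u" for u s
  proof (rule runs_For[where J = "?Ji u"])
    fix v s assume v: "v < n" and J: "?Ji u v s" and "fst s 7 = v"
    have "{..<u} \<times> {..<n} \<union> {u} \<times> {..<Suc v} = insert (u, v) ({..<u} \<times> {..<n} \<union> {u} \<times> {..<v})"
      by auto
    then show "runs body s (prog_size body)
      (\<lambda>s'. fst s' 7 = v \<and> ?Ji u (Suc v) ((fst s')(7 := Suc v), snd s'))"
      using step[OF \<open>u < n\<close> v, of _ s] J \<open>fst s 7 = v\<close>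
      by (intro runs_straight[OF straight]) (auto intro!: loop_reg')
  qed (use that bound loop_reg' in auto)
  have outer: "runs (For 6 (Seq (For 7 body) ?next)) s
    (Suc n * (Suc n * (prog_size body + for_size 7) + (bit_length 5 + exp_size (Add (Reg 5) (Reg 1))) + for_size 6)) Q"
    if "?Jo 0 s" for s
  proof (rule runs_For[where J = ?Jo])
    fix u s assume u: "u < n" "?Jo u s" "fst s 6 = u"
    show "runs (Seq (For 7 body) ?next) s
      (Suc n * (prog_size body + for_size 7) + (bit_length 5 + exp_size (Add (Reg 5) (Reg 1))))
      (\<lambda>s'. fst s' 6 = u \<and> ?Jo (Suc u) ((fst s')(6 := Suc u), snd s'))"
    proof (rule runs_Seq, rule runs_mono[OF inner[OF u] order_refl])
      fix s' assume s': "?Ji u n s'"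
      have "{..<Suc u} \<times> {..<n} = {..<u} \<times> {..<n} \<union> {u} \<times> {..<n}" by auto
      then show "runs ?next s' (bit_length 5 + exp_size (Add (Reg 5) (Reg 1)))
        (\<lambda>s'. fst s' 6 = u \<and> ?Jo (Suc u) ((fst s')(6 := Suc u), snd s'))"
        using s' bound[of _ s'] loop_reg'[of 6 _ "((fst s')(5 := x), snd s')" for x] loop_reg'[of 5 _ s']
        by (intro runs_Set_Reg) (auto simp: add.commute)
    qed
  qed (use that bound loop_reg' post in auto)
  show ?thesis
    unfolding For_Pairs_def pairs_size_def
    using init bound[OF init] loop_reg'[of 5 "{}" s]
    by (intro runs_Seq runs_Set_Reg outer) (auto simp: row_start_def)
qed

section \<open>Levels\<close>

locale bounded_rel =
  fixes n :: nat and E :: "nat rel"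
  assumes field: "E \<subseteq> {..<n} \<times> {..<n}"
    and neq: "(u, v) \<in> E \<Longrightarrow> u \<noteq> v"
    and relpow_bound: "E ^^ k \<noteq> {} \<Longrightarrow> k < n"
begin

text \<open>\<open>r\<close> rounds are complete and in the current round the arcs in \<open>S\<close> have been relaxed; \<open>A\<close>
  and \<open>B\<close> are lower bounds for the length of the longest walk ending and starting in a vertex,
  \<open>Q\<close> is the parity of \<open>A\<close>, and \<open>L\<close> is a lower bound for the length of the longest walk.\<close>

definition levels where
  "levels r S A B Q L \<longleftrightarrow>
     (\<forall>v<n. v \<in> Range (E ^^ A v) \<and> v \<in> Domain (E ^^ B v) \<and> A v \<le> L \<and> Q v = A v mod 2) \<and>
     E ^^ L \<noteq> {} \<and>
     (\<forall>v<n. \<forall>k\<le>r. (v \<in> Range (E ^^ k) \<longrightarrow> k \<le> A v) \<and> (v \<in> Domain (E ^^ k) \<longrightarrow> k \<le> B v)) \<and>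
     (\<forall>(u, v)\<in>S \<inter> E. \<forall>k\<le>r. (u \<in> Range (E ^^ k) \<longrightarrow> Suc k \<le> A v) \<and>
        (v \<in> Domain (E ^^ k) \<longrightarrow> Suc k \<le> B u))"

lemma levels_init: "levels 0 {} (\<lambda>_. 0) (\<lambda>_. 0) (\<lambda>_. 0) 0"
  unfolding levels_def by auto

lemma levels_skip: "levels r S A B Q L \<Longrightarrow> (u, v) \<notin> E \<Longrightarrow> levels r (insert (u, v) S) A B Q L"
  unfolding levels_def by auto

text \<open>Updates are made in place, so values may run ahead of the round. This is harmless: every
  value is the length of an actual walk, values only grow, and \<open>A u\<close> already dominates
  the walks of length at most \<open>r\<close> into \<open>u\<close>, so the new \<open>A v\<close>
  dominates their extensions by \<open>(u, v)\<close>. \<open>B\<close> is symmetric.\<close>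

lemma levels_relax:
  assumes lv: "levels r S A B Q L" and uv: "(u, v) \<in> E"
    and A': "A' = (if A v < Suc (A u) then A(v := Suc (A u)) else A)"
    and Q': "Q' = (if A v < Suc (A u) then Q(v := 1 - Q u) else Q)"
    and L': "L' = max L (A' v)"
    and B': "B' = (if B u < Suc (B v) then B(u := Suc (B v)) else B)"
  shows "levels r (insert (u, v) S) A' B' Q' L'"
proof -
  have n: "u < n" "v < n" using uv field by auto
  have ge: "A x \<le> A' x" "B x \<le> B' x" for x
    by (auto simp: A' B')
  have ge_uv: "Suc (A u) \<le> A' v" "Suc (B v) \<le> B' u"
    by (auto simp: A' B')
  have "v \<in> Range (E ^^ Suc (A u))"
  proof -
    have "u \<in> Range (E ^^ A u)" using lv n unfolding levels_def by blast
    then obtain w where "(w, u) \<in> E ^^ A u" by blast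
    then have "(w, v) \<in> E ^^ Suc (A u)" using uv by (rule relpow_Suc_I)
    then show ?thesis by blast
  qed
  then have A_walk: "\<forall>x<n. x \<in> Range (E ^^ A' x)"
    using lv unfolding A' levels_def by (auto simp del: relpow.simps)
  have "u \<in> Domain (E ^^ Suc (B v))"
  proof -
    have "v \<in> Domain (E ^^ B v)" using lv n unfolding levels_def by blast
    then obtain w where "(v, w) \<in> E ^^ B v" by blast
    then have "(u, w) \<in> E ^^ Suc (B v)" using uv by (rule relpow_Suc_I2[rotated])
    then show ?thesis by blast
  qed
  then have B_walk: "\<forall>x<n. x \<in> Domain (E ^^ B' x)"
    using lv unfolding B' levels_def by (auto simp del: relpow.simps)
  have parity: "\<forall>x<n. Q' x = A' x mod 2"
  proof -
    have "\<forall>x<n. Q x = A x mod 2" using lv unfolding levels_def by blast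
    then show ?thesis using n unfolding A' Q' by (auto simp: mod_Suc)
  qed
  have L_ge: "\<forall>x<n. A' x \<le> L'"
    using lv unfolding A' L' levels_def by auto
  have L_walk: "E ^^ L' \<noteq> {}"
    using lv A_walk n unfolding L' levels_def max_def by auto
  have rounds: "\<forall>x<n. \<forall>k\<le>r. (x \<in> Range (E ^^ k) \<longrightarrow> k \<le> A x) \<and> (x \<in> Domain (E ^^ k) \<longrightarrow> k \<le> B x)"
    using lv unfolding levels_def by blast
  have rounds': "(x \<in> Range (E ^^ k) \<longrightarrow> k \<le> A' x) \<and> (x \<in> Domain (E ^^ k) \<longrightarrow> k \<le> B' x)"
    if "x < n" "k \<le> r" for x k
    using rounds[rule_format, OF that] ge[of x] by linarith
  have current: "(x \<in> Range (E ^^ k) \<longrightarrow> Suc k \<le> A' y) \<and> (y \<in> Domain (E ^^ k) \<longrightarrow> Suc k \<le> B' x)"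
    if xy: "(x, y) \<in> insert (u, v) S \<inter> E" and "k \<le> r" for x y k
  proof (cases "(x, y) = (u, v)")
    case True
    have "(u \<in> Range (E ^^ k) \<longrightarrow> k \<le> A u) \<and> (v \<in> Domain (E ^^ k) \<longrightarrow> k \<le> B v)"
      using rounds n \<open>k \<le> r\<close> by blast
    then have "(u \<in> Range (E ^^ k) \<longrightarrow> Suc k \<le> A' v) \<and> (v \<in> Domain (E ^^ k) \<longrightarrow> Suc k \<le> B' u)"
      using ge_uv by linarith
    then show ?thesis using True by simp
  next
    case False
    then have "(x, y) \<in> S \<inter> E" using xy by blast
    then have "(x \<in> Range (E ^^ k) \<longrightarrow> Suc k \<le> A y) \<and> (y \<in> Domain (E ^^ k) \<longrightarrow> Suc k \<le> B x)"
      using lv \<open>k \<le> r\<close> unfolding levels_def by blast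
    then show ?thesis using ge(1)[of y] ge(2)[of x] by linarith
  qed
  show ?thesis
    unfolding levels_def
  proof (intro conjI)
    show "\<forall>v<n. v \<in> Range (E ^^ A' v) \<and> v \<in> Domain (E ^^ B' v) \<and> A' v \<le> L' \<and> Q' v = A' v mod 2"
      using A_walk B_walk parity L_ge by blast
  qed (use L_walk rounds' current in blast)+
qed

text \<open>Split a walk of length \<open>r + 1\<close> at its last arc for \<open>A\<close>, at its
  first arc for \<open>B\<close>; that arc was relaxed in this round, when the rest of the walk was
  already accounted for.\<close>

lemma levels_round:
  assumes "levels r ({..<n} \<times> {..<n}) A B Q L"
  shows "levels (Suc r) {} A B Q L"
proof -
  have S: "(u \<in> Range (E ^^ k) \<longrightarrow> Suc k \<le> A v) \<and> (v \<in> Domain (E ^^ k) \<longrightarrow> Suc k \<le> B u)"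
    if "(u, v) \<in> E" "k \<le> r" for u v k
  proof -
    have "(u, v) \<in> ({..<n} \<times> {..<n}) \<inter> E" using that field by blast
    then show ?thesis using assms that(2) unfolding levels_def by blast
  qed
  have "(v \<in> Range (E ^^ k) \<longrightarrow> k \<le> A v) \<and> (v \<in> Domain (E ^^ k) \<longrightarrow> k \<le> B v)"
    if "k \<le> Suc r" for v k
  proof (cases k)
    case (Suc l)
    then have "l \<le> r" using that by simp
    have "Suc l \<le> A v" if walk: "v \<in> Range (E ^^ Suc l)"
    proof -
      obtain x where "(x, v) \<in> E ^^ Suc l" using walk by (rule RangeE)
      then obtain u where "(x, u) \<in> E ^^ l" "(u, v) \<in> E" by (rule relpow_Suc_E)
      then show ?thesis using S[of u v l] \<open>l \<le> r\<close> by blast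
    qed
    moreover have "Suc l \<le> B v" if walk: "v \<in> Domain (E ^^ Suc l)"
    proof -
      obtain x where "(v, x) \<in> E ^^ Suc l" using walk by (rule DomainE)
      then obtain u where "(v, u) \<in> E" "(u, x) \<in> E ^^ l" by (rule relpow_Suc_E2)
      then show ?thesis using S[of v u l] \<open>l \<le> r\<close> by blast
    qed
    ultimately show ?thesis using Suc by blast
  qed simp
  then show ?thesis using assms unfolding levels_def by blast
qed

text \<open>No walk has \<open>n\<close> or more arcs, so after \<open>n\<close> rounds the
  restriction to lengths up to \<open>r\<close> is vacuous and the lower bounds are exact.\<close>

lemma levels_max:
  assumes "levels n {} A B Q L" "v < n"
  shows "v \<in> Range (E ^^ A v)" "v \<in> Domain (E ^^ B v)" "Q v = A v mod 2"
    and "v \<in> Range (E ^^ k) \<Longrightarrow> k \<le> A v" "v \<in> Domain (E ^^ k) \<Longrightarrow> k \<le> B v"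
proof -
  have "k \<le> n" if "E ^^ k \<noteq> {}" for k using relpow_bound[OF that] by simp
  then show "v \<in> Range (E ^^ k) \<Longrightarrow> k \<le> A v" "v \<in> Domain (E ^^ k) \<Longrightarrow> k \<le> B v"
    using assms unfolding levels_def by blast+
qed (use assms in \<open>auto simp: levels_def\<close>)

lemma levels_longest:
  assumes "levels n {} A B Q L"
  shows "is_longest E L"
  unfolding is_longest_def
proof (intro conjI allI impI)
  show "E ^^ L \<noteq> {}" using assms unfolding levels_def by blast
  fix k assume k: "E ^^ k \<noteq> {}"
  show "k \<le> L"
  proof (cases k)
    case (Suc l)
    obtain u v where uv: "(u, v) \<in> E ^^ k" using k by auto
    then obtain w where "(w, v) \<in> E" using Suc by auto
    then have "v < n" using field by auto
    then have "k \<le> A v" using levels_max(4)[OF assms] uv by blast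
    then show ?thesis using assms \<open>v < n\<close> unfolding levels_def by (meson order_trans)
  qed simp
qed

text \<open>\<open>A u + B v + 1\<close> never exceeds \<open>L\<close>, so the strict inequality
  amounts to equality. Any witnesses \<open>i\<close>, \<open>j\<close> are bounded by
  \<open>A u\<close>, \<open>B v\<close> and sum to \<open>L - 1\<close>, hence equal them; so the
  parity of \<open>A u\<close> decides.\<close>

lemma levels_critical:
  assumes lv: "levels n {} A B Q L" and uv: "(u, v) \<in> E"
  shows "(u, v) \<in> critical_arcs E L \<longleftrightarrow> Q u < 1 \<and> L < A u + B v + 2"
proof -
  have n: "u < n" "v < n" using uv field by auto
  note u = levels_max[OF lv n(1)] and v = levels_max[OF lv n(2)]
  have le_L: "Suc (A u + B v) \<le> L"
  proof -
    obtain x y where "(x, u) \<in> E ^^ A u" "(v, y) \<in> E ^^ B v"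
      using u(1) v(2) by blast
    then have "(x, y) \<in> E ^^ (Suc (A u) + B v)"
      using uv unfolding relpow_add by auto
    then have "E ^^ Suc (A u + B v) \<noteq> {}" by (auto simp del: relpow.simps)
    then show ?thesis using levels_longest[OF lv] unfolding is_longest_def by blast
  qed
  have even: "Q u < 1 \<longleftrightarrow> even (A u)"
    using u(3) by (simp add: even_iff_mod_2_eq_zero)
  show ?thesis
  proof
    assume "(u, v) \<in> critical_arcs E L"
    then obtain i j where ij: "even i" "u \<in> Range (E ^^ i)" "v \<in> Domain (E ^^ j)" "Suc (i + j) = L"
      unfolding critical_arcs_def by blast
    then have "i = A u \<and> j = B v"
      using u(4)[OF ij(2)] v(5)[OF ij(3)] le_L by linarith
    then show "Q u < 1 \<and> L < A u + B v + 2"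
      using even ij by simp
  next
    assume "Q u < 1 \<and> L < A u + B v + 2"
    then have "even (A u)" "Suc (A u + B v) = L"
      using even le_L by auto
    then show "(u, v) \<in> critical_arcs E L"
      unfolding critical_arcs_def using uv u(1) v(2) by blast
  qed
qed

end

section \<open>Greedy matching\<close>

text \<open>The label of an unmatched vertex is the vertex itself; both ends of a matched arc \<open>(u, v)\<close>
  get the label \<open>n + u\<close>.\<close>

definition matching_labels :: "nat \<Rightarrow> nat rel \<Rightarrow> nat rel \<Rightarrow> (nat \<Rightarrow> nat) \<Rightarrow> bool" where
  "matching_labels n F S l \<longleftrightarrow>
     (\<forall>x<n. l x = x \<or> (\<exists>u v. (u, v) \<in> F \<and> x \<in> {u, v} \<and> l x = n + u \<and> {y. y < n \<and> l y = n + u} = {u, v})) \<and>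
     (\<forall>(u, v)\<in>S \<inter> F. n \<le> l u \<or> n \<le> l v)"

lemma matching_labels_init:
  assumes "\<forall>x<n. l x = x"
  shows "matching_labels n F {} l"
  using assms unfolding matching_labels_def by simp

lemma matching_labels_skip:
  assumes "matching_labels n F S l" "(u, v) \<in> F \<longrightarrow> n \<le> l u \<or> n \<le> l v"
  shows "matching_labels n F (insert (u, v) S) l"
  using assms unfolding matching_labels_def by auto

lemma matching_labels_match:
  assumes ml: "matching_labels n F S l" and F: "(u, v) \<in> F" "F \<subseteq> {..<n} \<times> {..<n}"
    and free: "l u < n" "l v < n"
  shows "matching_labels n F (insert (u, v) S) (l(u := n + u, v := n + u))"
proof -
  let ?l = "l(u := n + u, v := n + u)"
  have n: "u < n" "v < n" using F by auto
  \<comment> \<open>A class with label \<open>n + u\<close> would contain \<open>u\<close> itself,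
    but \<open>u\<close> is still free.\<close>
  have fresh: "l y \<noteq> n + u" if "y < n" for y
  proof
    assume y: "l y = n + u"
    then obtain u' v' where "(u', v') \<in> F" "l y = n + u'" "{y. y < n \<and> l y = n + u'} = {u', v'}"
      using ml \<open>y < n\<close> unfolding matching_labels_def by (metis add_leD1 leD le_add1)
    then have "l u = n + u" using y by auto
    then show False using free by simp
  qed
  have cls: "{y. y < n \<and> ?l y = n + u} = {u, v}"
    using fresh n by (auto split: if_splits)
  have "?l x = x \<or> (\<exists>u v. (u, v) \<in> F \<and> x \<in> {u, v} \<and> ?l x = n + u \<and> {y. y < n \<and> ?l y = n + u} = {u, v})"
    if x: "x < n" for x
  proof (cases "x \<in> {u, v}")
    case True
    then have "?l x = n + u" by auto
    then show ?thesis using F(1) cls True by blast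
  next
    case False
    then have l: "?l x = l x" by simp
    show ?thesis
    proof (cases "l x = x")
      case False
      then obtain u' v' where uv': "(u', v') \<in> F" "x \<in> {u', v'}" "l x = n + u'"
        "{y. y < n \<and> l y = n + u'} = {u', v'}"
        using ml x unfolding matching_labels_def by blast
      then have "u' \<noteq> u" using fresh[OF x] by auto
      \<comment> \<open>Both \<open>u\<close> and \<open>v\<close> had labels below
        \<open>n\<close>, so no older class loses a member.\<close>
      then have "{y. y < n \<and> ?l y = n + u'} = {y. y < n \<and> l y = n + u'}"
        using free by auto
      then show ?thesis using uv' l by auto
    qed (use l in simp)
  qed
  moreover have "n \<le> ?l x \<or> n \<le> ?l y" if "(x, y) \<in> insert (u, v) S \<inter> F" for x y
    using that ml unfolding matching_labels_def by auto
  ultimately show ?thesis unfolding matching_labels_def by blast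
qed

lemma matching_labels_class:
  assumes "matching_labels n F S l" "F \<subseteq> {..<n} \<times> {..<n}" "x < n"
  shows "card {y. y < n \<and> l y = l x} \<le> 2"
proof (cases "l x = x")
  case True
  have "{y. y < n \<and> l y = l x} \<subseteq> {x}"
  proof
    fix y assume y: "y \<in> {y. y < n \<and> l y = l x}"
    then have "l y = y \<or> n \<le> l y"
      using assms(1) unfolding matching_labels_def by (metis (no_types, lifting) le_add1 mem_Collect_eq)
    then show "y \<in> {x}" using y True \<open>x < n\<close> by auto
  qed
  then have "card {y. y < n \<and> l y = l x} \<le> card {x}"
    by (rule card_mono[rotated]) simp
  then show ?thesis by simp
next
  case False
  then obtain u v where "l x = n + u" "{y. y < n \<and> l y = n + u} = {u, v}"
    using assms unfolding matching_labels_def by blast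
  then show ?thesis by (simp add: card_insert_if)
qed

text \<open>If an arc was passed over, one of its ends was taken by an arc of \<open>F\<close>; in a
  matching that arc has the same two ends, so the label is shared anyway.\<close>

lemma matching_labels_complete:
  assumes ml: "matching_labels n F ({..<n} \<times> {..<n}) l" and F: "F \<subseteq> {..<n} \<times> {..<n}"
    and matching: "\<And>u v u' v'. (u, v) \<in> F \<Longrightarrow> (u', v') \<in> F \<Longrightarrow> {u, v} \<inter> {u', v'} \<noteq> {} \<Longrightarrow>
      {u, v} = {u', v'}"
    and uv: "(u, v) \<in> F"
  shows "l u = l v"
proof -
  have n: "u < n" "v < n" using F uv by auto
  have "(u, v) \<in> ({..<n} \<times> {..<n}) \<inter> F" using uv n by simp
  then have "n \<le> l u \<or> n \<le> l v"
    using ml unfolding matching_labels_def by blast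
  then obtain x where x: "x \<in> {u, v}" "n \<le> l x"
    by blast
  then have "x < n" "l x \<noteq> x" using n by auto
  then obtain u' v' where uv': "(u', v') \<in> F" "x \<in> {u', v'}" "{y. y < n \<and> l y = n + u'} = {u', v'}"
    using ml unfolding matching_labels_def by meson
  have "{u, v} \<inter> {u', v'} \<noteq> {}"
    using x(1) uv'(2) by blast
  then have "{u, v} = {y. y < n \<and> l y = n + u'}"
    using matching[OF uv uv'(1)] uv'(3) by simp
  then have "u \<in> {y. y < n \<and> l y = n + u'}" "v \<in> {y. y < n \<and> l y = n + u'}"
    by (metis insert_iff)+
  then show ?thesis by simp
qed

section \<open>The program\<close>

text \<open>The input occupies \<open>7 + 4n + n\<^sup>2\<close> cells. Behind it the program keeps the arrays \<open>A\<close>,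
  \<open>B\<close> and \<open>Q\<close>, at the addresses in registers 2, 3 and 4; register 9 holds \<open>L\<close>. The labels are
  written to the cells \<open>0, \<dots>, n - 1\<close>, in front of the adjacency matrix.\<close>

abbreviation entry :: "nat \<Rightarrow> nat \<Rightarrow> ram_exp" where
  "entry b i \<equiv> Mem (Add (Reg b) (Reg i))"

definition Guarded :: "ram_cond \<Rightarrow> ram_prog \<Rightarrow> ram_prog" where
  "Guarded b c = Ite b c Skip"

definition init_regs :: ram_prog where
  "init_regs = Seq (Set_Reg 1 (Mem (Const 0))) (Seq (Set_Reg 2 (Reg 0))
     (Seq (Set_Reg 3 (Add (Reg 2) (Reg 1))) (Set_Reg 4 (Add (Reg 3) (Reg 1)))))"

text \<open>\<open>A v\<close> becomes \<open>A u + 1\<close>, so its parity is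
  \<open>1 - Q u\<close>; this replaces a division by 2.\<close>

definition relax_A :: ram_prog where
  "relax_A = Guarded (Less (entry 2 7) (Add (entry 2 6) (Const 1)))
     (Seq (Set_Mem (Add (Reg 2) (Reg 7)) (Add (entry 2 6) (Const 1)))
       (Set_Mem (Add (Reg 4) (Reg 7)) (Sub (Const 1) (entry 4 6))))"

definition relax_L :: ram_prog where
  "relax_L = Guarded (Less (Reg 9) (entry 2 7)) (Set_Reg 9 (entry 2 7))"

definition relax_B :: ram_prog where
  "relax_B = Guarded (Less (entry 3 6) (Add (entry 3 7) (Const 1)))
     (Set_Mem (Add (Reg 3) (Reg 6)) (Add (entry 3 7) (Const 1)))"

definition relax :: ram_prog where
  "relax = Guarded (Less (Const 0) (entry 5 7)) (Seq relax_A (Seq relax_L relax_B))"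

text \<open>The second and third guards are the test of \<open>levels_critical\<close>. A label
  below \<open>n\<close> marks a free vertex, so no separate flags are kept.\<close>

definition match :: ram_prog where
  "match = Guarded (Less (Const 0) (entry 5 7))
     (Guarded (Less (entry 4 6) (Const 1))
     (Guarded (Less (Reg 9) (Add (Add (entry 2 6) (entry 3 7)) (Const 2)))
     (Guarded (Less (Mem (Reg 6)) (Reg 1))
     (Guarded (Less (Mem (Reg 7)) (Reg 1))
       (Seq (Set_Mem (Reg 6) (Add (Reg 1) (Reg 6))) (Set_Mem (Reg 7) (Add (Reg 1) (Reg 6))))))))"

text \<open>The labels may overwrite the front of the input, since \<open>n\<close> has been copied
  to register 1 and later reads concern the labels, the matrix and the arrays behind it.\<close>

definition program :: ram_prog where
  "program = Seq init_regs (Seq (For 8 (For_Pairs relax))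
     (Seq (For 7 (Set_Mem (Reg 7) (Reg 7))) (Seq (For_Pairs match) (Set_Reg 0 (Reg 1)))))"

definition program_size :: "nat \<Rightarrow> nat" where
  "program_size n = prog_size init_regs + (Suc n * (pairs_size n (prog_size relax) + for_size 8) +
     (Suc n * (prog_size (Set_Mem (Reg 7) (Reg 7)) + for_size 7) +
       (pairs_size n (prog_size match) + prog_size (Set_Reg 0 (Reg 1)))))"

lemma straight_program:
  "straight init_regs" "straight relax" "straight match"
  by (simp_all add: init_regs_def relax_def relax_A_def relax_L_def relax_B_def match_def Guarded_def)

definition input_length :: "nat \<Rightarrow> nat" where
  "input_length n = 7 + 4 * n + n * n"

lemma matrix_index_less:
  assumes "u < n" "v < n"
  shows "7 + 4 * n + u * n + v < input_length n"
proof -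
  have "u * n + v < Suc u * n" using assms by simp
  also have "\<dots> \<le> n * n" using assms by (intro mult_right_mono) auto
  finally show ?thesis by (simp add: input_length_def)
qed

section \<open>Memory layout\<close>

definition represents :: "nat \<Rightarrow> nat rel \<Rightarrow> (nat \<Rightarrow> nat) \<Rightarrow> (nat \<Rightarrow> nat) \<Rightarrow> (nat \<Rightarrow> nat) \<Rightarrow>
    nat \<Rightarrow> ram_state \<Rightarrow> bool" where
  "represents n E A B Q L s \<longleftrightarrow>
     fst s 1 = n \<and> fst s 2 = input_length n \<and> fst s 3 = input_length n + n \<and>
     fst s 4 = input_length n + 2 * n \<and> fst s 9 = L \<and>
     (\<forall>u<n. \<forall>v<n. snd s (7 + 4 * n + u * n + v) = of_bool ((u, v) \<in> E)) \<and>
     (\<forall>v<n. snd s (input_length n + v) = A v \<and> snd s (input_length n + n + v) = B v \<and>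
       snd s (input_length n + 2 * n + v) = Q v)"

lemma representsD:
  assumes "represents n E A B Q L s"
  shows "fst s (Suc 0) = n" "fst s 2 = input_length n" "fst s 3 = input_length n + n"
    "fst s 4 = input_length n + 2 * n" "fst s 9 = L"
    "\<lbrakk>u < n; v < n\<rbrakk> \<Longrightarrow> snd s (7 + 4 * n + u * n + v) = of_bool ((u, v) \<in> E)"
    "v < n \<Longrightarrow> snd s (input_length n + v) = A v"
    "v < n \<Longrightarrow> snd s (input_length n + n + v) = B v"
    "v < n \<Longrightarrow> snd s (input_length n + 2 * n + v) = Q v"
  using assms unfolding represents_def by auto

lemma represents_write:
  assumes "represents n E A B Q L s" and "v < n"
  shows represents_write_A:
      "represents n E (A(v := x)) B Q L (fst s, (snd s)(input_length n + v := x))" (is ?A)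
    and represents_write_B:
      "represents n E A (B(v := x)) Q L (fst s, (snd s)(input_length n + n + v := x))" (is ?B)
    and represents_write_Q:
      "represents n E A B (Q(v := x)) L (fst s, (snd s)(input_length n + 2 * n + v := x))" (is ?Q)
    and represents_write_label:
      "represents n E A B Q L (fst s, (snd s)(v := x))" (is ?l)
proof -
  have *: "7 + 4 * n + a * n + b \<noteq> input_length n + c" if "a < n" "b < n" for a b c
    using matrix_index_less[OF that] by simp
  \<comment> \<open>Labels occupy cells below \<open>n\<close>, hence in front of the matrix, which
    starts at \<open>7 + 4 * n\<close>.\<close>
  have **: "7 + 4 * n + a * n + b \<noteq> v" "input_length n + c \<noteq> v" for a b c
    using \<open>v < n\<close> by (auto simp: input_length_def)
  note reads = representsD[OF assms(1)]
  show ?A ?B ?Q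
    unfolding represents_def fst_conv snd_conv
    using reads * \<open>v < n\<close> by (auto simp: add.assoc)
  show ?l
    unfolding represents_def fst_conv snd_conv
    using reads ** by (auto simp: add.assoc)
qed

lemma represents_write_L:
  "represents n E A B Q L s \<Longrightarrow> represents n E A B Q x ((fst s)(9 := x), snd s)"
  unfolding represents_def by simp

lemma represents_other_reg:
  assumes "i \<in> {5, 6, 7, 8}"
  shows "represents n E A B Q L (regs(i := x), mem) \<longleftrightarrow> represents n E A B Q L (regs, mem)"
  using assms unfolding represents_def by auto

section \<open>Effect of the loop bodies\<close>

lemma effect_relax_A:
  assumes rep: "represents n E A B Q L s" and "fst s 6 = u" "fst s 7 = v" "u < n" "v < n" "u \<noteq> v"
  shows "represents n E (if A v < Suc (A u) then A(v := Suc (A u)) else A) B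
      (if A v < Suc (A u) then Q(v := 1 - Q u) else Q) L (effect relax_A s)"
    and "fst (effect relax_A s) = fst s"
proof -
  note reads = representsD[OF rep]
  let ?s = "(fst s, (snd s)(input_length n + v := Suc (A u)))"
  have s: "represents n E (A(v := Suc (A u))) B Q L ?s"
    by (rule represents_write_A[OF rep \<open>v < n\<close>])
  have "effect relax_A s = (if A v < Suc (A u)
    then (fst ?s, (snd ?s)(input_length n + 2 * n + v := 1 - Q u)) else s)"
    using assms reads representsD(9)[OF s \<open>u < n\<close>] unfolding relax_A_def Guarded_def by simp
  then show "represents n E (if A v < Suc (A u) then A(v := Suc (A u)) else A) B
      (if A v < Suc (A u) then Q(v := 1 - Q u) else Q) L (effect relax_A s)"
    and "fst (effect relax_A s) = fst s"
    using represents_write_Q[OF s \<open>v < n\<close>, of "1 - Q u"] rep by auto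
qed

lemma effect_relax_L:
  assumes rep: "represents n E A B Q L s" and "fst s 7 = v" "v < n"
  shows "represents n E A B Q (max L (A v)) (effect relax_L s)"
    and "i \<noteq> 9 \<Longrightarrow> fst (effect relax_L s) i = fst s i"
  using assms representsD[OF rep] represents_write_L[OF rep, of "A v"]
  unfolding relax_L_def Guarded_def by (auto simp: max_def not_less)

lemma effect_relax_B:
  assumes rep: "represents n E A B Q L s" and "fst s 6 = u" "fst s 7 = v" "u < n" "v < n"
  shows "represents n E A (if B u < Suc (B v) then B(u := Suc (B v)) else B) Q L (effect relax_B s)"
    and "fst (effect relax_B s) = fst s"
  using assms representsD[OF rep] represents_write_B[OF rep \<open>u < n\<close>, of "Suc (B v)"]
  unfolding relax_B_def Guarded_def by auto

context bounded_rel
begin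

lemma effect_relax:
  assumes rep: "represents n E A B Q L s" and lv: "levels r S A B Q L"
    and uv: "u < n" "v < n" "fst s 5 = 7 + 4 * n + u * n" "fst s 6 = u" "fst s 7 = v"
  shows "\<exists>A B Q L. represents n E A B Q L (effect relax s) \<and> levels r (insert (u, v) S) A B Q L"
    and "i \<noteq> 9 \<Longrightarrow> fst (effect relax s) i = fst s i"
proof -
  note reads = representsD[OF rep]
  show "\<exists>A B Q L. represents n E A B Q L (effect relax s) \<and> levels r (insert (u, v) S) A B Q L"
    and "i \<noteq> 9 \<Longrightarrow> fst (effect relax s) i = fst s i"
  proof (atomize (full), cases "(u, v) \<in> E")
    case False
    then have "effect relax s = s"
      using uv reads(6) unfolding relax_def Guarded_def by simp
    then show "(\<exists>A B Q L. represents n E A B Q L (effect relax s) \<and> levels r (insert (u, v) S) A B Q L) \<and>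
      (i \<noteq> 9 \<longrightarrow> fst (effect relax s) i = fst s i)"
      using rep levels_skip[OF lv False] by metis
  next
    case True
    define A' B' Q' L' where
      "A' = (if A v < Suc (A u) then A(v := Suc (A u)) else A)" and
      "B' = (if B u < Suc (B v) then B(u := Suc (B v)) else B)" and
      "Q' = (if A v < Suc (A u) then Q(v := 1 - Q u) else Q)" and
      "L' = max L (A' v)"
    let ?s1 = "effect relax_A s"
    let ?s2 = "effect relax_L ?s1"
    have e: "effect relax s = effect relax_B ?s2"
      using True uv reads(6) unfolding relax_def Guarded_def by simp
    have 1: "represents n E A' B Q' L ?s1" "fst ?s1 = fst s"
      unfolding A'_def Q'_def using effect_relax_A[OF rep] uv neq[OF True] by blast+
    have 2: "represents n E A' B Q' L' ?s2" "i \<noteq> 9 \<Longrightarrow> fst ?s2 i = fst s i" for i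
      unfolding L'_def using effect_relax_L[OF 1(1), of v] 1(2) uv by auto
    have 3: "represents n E A' B' Q' L' (effect relax s)" "fst (effect relax s) = fst ?s2"
      unfolding e B'_def using effect_relax_B[OF 2(1), of u v] 2(2) uv by auto
    have "levels r (insert (u, v) S) A' B' Q' L'"
      by (rule levels_relax[OF lv True A'_def Q'_def L'_def B'_def])
    then show "(\<exists>A B Q L. represents n E A B Q L (effect relax s) \<and> levels r (insert (u, v) S) A B Q L) \<and>
      (i \<noteq> 9 \<longrightarrow> fst (effect relax s) i = fst s i)"
      using 2(2) 3 by auto
  qed
qed

lemma runs_relax_round:
  assumes "represents n E A B Q L s" "levels r {} A B Q L" "fst s 8 = r"
  shows "runs (For_Pairs relax) s (pairs_size n (prog_size relax))
    (\<lambda>s. fst s 8 = r \<and> (\<exists>A B Q L. represents n E A B Q L s \<and> levels (Suc r) {} A B Q L))"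
proof (rule runs_For_Pairs[where
      J = "\<lambda>S s. fst s 8 = r \<and> (\<exists>A B Q L. represents n E A B Q L s \<and> levels r S A B Q L)"])
  fix S regs mem x and i :: nat
  assume i: "i \<in> {5, 6, 7}"
    and J: "fst (regs, mem) 8 = r \<and> (\<exists>A B Q L. represents n E A B Q L (regs, mem) \<and> levels r S A B Q L)"
  show "fst (regs(i := x), mem) 8 = r \<and>
    (\<exists>A B Q L. represents n E A B Q L (regs(i := x), mem) \<and> levels r S A B Q L)"
    using i J represents_other_reg[of i] by auto
next
  fix S s u v
  assume uv: "u < n" "v < n" "fst s 5 = 7 + 4 * n + u * n" "fst s 6 = u" "fst s 7 = v"
    and J: "fst s 8 = r \<and> (\<exists>A B Q L. represents n E A B Q L s \<and> levels r S A B Q L)"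
  then obtain A B Q L where AB: "represents n E A B Q L s" "levels r S A B Q L" by blast
  show "(fst (effect relax s) 8 = r \<and>
      (\<exists>A B Q L. represents n E A B Q L (effect relax s) \<and> levels r (insert (u, v) S) A B Q L)) \<and>
    (\<forall>i\<in>{5, 6, 7}. fst (effect relax s) i = fst s i)"
    using effect_relax[OF AB uv] J by auto
next
  fix s assume "fst s 8 = r \<and> (\<exists>A B Q L. represents n E A B Q L s \<and> levels r ({..<n} \<times> {..<n}) A B Q L)"
  then show "fst s 8 = r \<and> (\<exists>A B Q L. represents n E A B Q L s \<and> levels (Suc r) {} A B Q L)"
    using levels_round by blast
qed (use assms straight_program in \<open>auto dest: representsD(1)\<close>)

lemma runs_relax_all:
  assumes "represents n E (\<lambda>_. 0) (\<lambda>_. 0) (\<lambda>_. 0) 0 s"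
  shows "runs (For 8 (For_Pairs relax)) s (Suc n * (pairs_size n (prog_size relax) + for_size 8))
    (\<lambda>s. \<exists>A B Q L. represents n E A B Q L s \<and> levels n {} A B Q L)"
proof (rule runs_For[where J = "\<lambda>r s. \<exists>A B Q L. represents n E A B Q L s \<and> levels r {} A B Q L"])
  fix r s assume J: "\<exists>A B Q L. represents n E A B Q L s \<and> levels r {} A B Q L" and "fst s 8 = r"
  then obtain A B Q L where "represents n E A B Q L s" "levels r {} A B Q L" by blast
  from runs_relax_round[OF this \<open>fst s 8 = r\<close>]
  show "runs (For_Pairs relax) s (pairs_size n (prog_size relax))
    (\<lambda>s'. fst s' 8 = r \<and> (\<exists>A B Q L. represents n E A B Q L ((fst s')(8 := Suc r), snd s') \<and>
      levels (Suc r) {} A B Q L))"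
    by (rule runs_mono) (auto simp: represents_other_reg)
next
  show "\<exists>A B Q L. represents n E A B Q L ((fst s)(8 := 0), snd s) \<and> levels 0 {} A B Q L"
    using assms levels_init by (auto simp: represents_other_reg)
qed (auto dest: representsD(1))

lemma runs_init_labels:
  assumes "represents n E A B Q L s"
  shows "runs (For 7 (Set_Mem (Reg 7) (Reg 7))) s
    (Suc n * (prog_size (Set_Mem (Reg 7) (Reg 7)) + for_size 7))
    (\<lambda>s. represents n E A B Q L s \<and> (\<forall>x<n. snd s x = x))"
proof (rule runs_For[where J = "\<lambda>j s. represents n E A B Q L s \<and> (\<forall>x<j. snd s x = x)"])
  fix j s assume "j < n" "represents n E A B Q L s \<and> (\<forall>x<j. snd s x = x)" "fst s 7 = j"
  then show "runs (Set_Mem (Reg 7) (Reg 7)) s (prog_size (Set_Mem (Reg 7) (Reg 7)))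
    (\<lambda>s'. fst s' 7 = j \<and> represents n E A B Q L ((fst s')(7 := Suc j), snd s') \<and>
      (\<forall>x<Suc j. snd ((fst s')(7 := Suc j), snd s') x = x))"
    using represents_write_label[of n E A B Q L s j j]
    by (intro runs_straight) (auto simp: represents_other_reg less_Suc_eq)
qed (use assms in \<open>auto simp: represents_other_reg dest: representsD(1)\<close>)

lemma effect_match:
  assumes rep: "represents n E A B Q L s" and lv: "levels n {} A B Q L"
    and ml: "matching_labels n (critical_arcs E L) S (snd s)"
    and uv: "u < n" "v < n" "fst s 5 = 7 + 4 * n + u * n" "fst s 6 = u" "fst s 7 = v"
  shows "represents n E A B Q L (effect match s) \<and> fst (effect match s) = fst s \<and>
    matching_labels n (critical_arcs E L) (insert (u, v) S) (snd (effect match s))"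
proof -
  note reads = representsD[OF rep]
  let ?s = "(fst s, (snd s)(u := n + u, v := n + u))"
  have F: "critical_arcs E L \<subseteq> {..<n} \<times> {..<n}"
    using field unfolding critical_arcs_def by auto
  have crit: "(u, v) \<in> critical_arcs E L \<longleftrightarrow> (u, v) \<in> E \<and> Q u < 1 \<and> L < A u + B v + 2"
    using levels_critical[OF lv, of u v] by (auto simp: critical_arcs_def)
  have "effect match s =
    (if (u, v) \<in> critical_arcs E L \<and> snd s u < n \<and> snd s v < n then ?s else s)"
  proof (cases "(u, v) \<in> E \<and> Q u < 1 \<and> L < A u + B v + 2 \<and> snd s u < n \<and> snd s v < n")
    case True
    then show ?thesis
      using uv reads reads(6)[OF uv(1,2)] crit unfolding match_def Guarded_def by simp
  next
    case False
    then have "effect match s = s"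
      using uv reads reads(6)[OF uv(1,2)] unfolding match_def Guarded_def by auto
    then show ?thesis using False crit by auto
  qed
  moreover have "represents n E A B Q L ?s"
    using represents_write_label[OF represents_write_label[OF rep uv(1)] uv(2)] by simp
  moreover have "matching_labels n (critical_arcs E L) (insert (u, v) S) (snd s)"
    if "\<not> ((u, v) \<in> critical_arcs E L \<and> snd s u < n \<and> snd s v < n)"
    using that by (intro matching_labels_skip[OF ml]) auto
  moreover have "matching_labels n (critical_arcs E L) (insert (u, v) S) (snd ?s)"
    if "(u, v) \<in> critical_arcs E L \<and> snd s u < n \<and> snd s v < n"
    using matching_labels_match[OF ml _ F] that by simp
  ultimately show ?thesis using rep by auto
qed

lemma runs_match_all:
  assumes rep: "represents n E A B Q L s" and lv: "levels n {} A B Q L" and "\<forall>x<n. snd s x = x"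
  shows "runs (For_Pairs match) s (pairs_size n (prog_size match))
    (\<lambda>s. fst s 1 = n \<and> matching_labels n (critical_arcs E L) ({..<n} \<times> {..<n}) (snd s))"
proof (rule runs_For_Pairs[where J = "\<lambda>S s. represents n E A B Q L s \<and>
      matching_labels n (critical_arcs E L) S (snd s)"])
  fix S s u v
  assume uv: "u < n" "v < n" "fst s 5 = 7 + 4 * n + u * n" "fst s 6 = u" "fst s 7 = v"
    and J: "represents n E A B Q L s \<and> matching_labels n (critical_arcs E L) S (snd s)"
  show "(represents n E A B Q L (effect match s) \<and>
      matching_labels n (critical_arcs E L) (insert (u, v) S) (snd (effect match s))) \<and>
    (\<forall>i\<in>{5, 6, 7}. fst (effect match s) i = fst s i)"
    using effect_match[OF conjunct1[OF J] lv conjunct2[OF J] uv] by simp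
qed (use assms straight_program matching_labels_init in
    \<open>auto simp: represents_other_reg dest: representsD(1)\<close>)

lemma runs_program:
  assumes "fst s = (\<lambda>_. 0)(0 := input_length n)" "snd s 0 = n"
    and "\<And>u v. \<lbrakk>u < n; v < n\<rbrakk> \<Longrightarrow> snd s (7 + 4 * n + u * n + v) = of_bool ((u, v) \<in> E)"
    and "\<And>a. input_length n \<le> a \<Longrightarrow> snd s a = 0"
  shows "runs program s (program_size n) (\<lambda>s. fst s 0 = n \<and> (\<exists>L. is_longest E L \<and>
    matching_labels n (critical_arcs E L) ({..<n} \<times> {..<n}) (snd s)))"
  unfolding program_def program_size_def
proof (rule runs_Seq, rule runs_straight[OF straight_program(1)], rule runs_Seq,
    rule runs_mono[OF runs_relax_all order_refl])
  \<comment> \<open>Memory behind the input and register 9 are zero at the start, which already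
    encodes \<open>levels_init\<close>.\<close>
  show "represents n E (\<lambda>_. 0) (\<lambda>_. 0) (\<lambda>_. 0) 0 (effect init_regs s)"
    unfolding represents_def init_regs_def using assms by simp
next
  fix s assume "\<exists>A B Q L. represents n E A B Q L s \<and> levels n {} A B Q L"
  then obtain A B Q L where rep: "represents n E A B Q L s" and lv: "levels n {} A B Q L" by blast
  show "runs (Seq (For 7 (Set_Mem (Reg 7) (Reg 7))) (Seq (For_Pairs match) (Set_Reg 0 (Reg 1)))) s
    (Suc n * (prog_size (Set_Mem (Reg 7) (Reg 7)) + for_size 7) +
      (pairs_size n (prog_size match) + prog_size (Set_Reg 0 (Reg 1))))
    (\<lambda>s. fst s 0 = n \<and> (\<exists>L. is_longest E L \<and>
      matching_labels n (critical_arcs E L) ({..<n} \<times> {..<n}) (snd s)))"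
  proof (rule runs_Seq, rule runs_mono[OF runs_init_labels[OF rep] order_refl], rule runs_Seq)
    fix s assume s: "represents n E A B Q L s \<and> (\<forall>x<n. snd s x = x)"
    show "runs (For_Pairs match) s (pairs_size n (prog_size match)) (\<lambda>s.
      runs (Set_Reg 0 (Reg 1)) s (prog_size (Set_Reg 0 (Reg 1))) (\<lambda>s. fst s 0 = n \<and>
        (\<exists>L. is_longest E L \<and>
          matching_labels n (critical_arcs E L) ({..<n} \<times> {..<n}) (snd s))))"
    proof (rule runs_mono[OF runs_match_all[OF _ lv] order_refl])
      fix s' :: ram_state
      assume "fst s' 1 = n \<and> matching_labels n (critical_arcs E L) ({..<n} \<times> {..<n}) (snd s')"
      then show "runs (Set_Reg 0 (Reg 1)) s' (prog_size (Set_Reg 0 (Reg 1))) (\<lambda>s. fst s 0 = n \<and>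
        (\<exists>L. is_longest E L \<and>
          matching_labels n (critical_arcs E L) ({..<n} \<times> {..<n}) (snd s)))"
        using levels_longest[OF lv] by (intro runs_straight) auto
    qed (use s in auto)
  qed
qed

end

section \<open>Encoding and running time\<close>

lemma length_concat_const:
  "(\<And>x. x \<in> set xs \<Longrightarrow> length (f x) = m) \<Longrightarrow> length (concat (map f xs)) = length xs * m"
  by (induction xs) auto

lemma nth_concat_const:
  assumes "\<And>i. i < n \<Longrightarrow> length (f i) = m" "u < n" "v < m"
  shows "concat (map f [0..<n]) ! (u * m + v) = f u ! v"
  using assms
proof (induction n)
  case (Suc n)
  have len: "length (concat (map f [0..<n])) = n * m"
    using Suc.prems(1) by (subst length_concat_const[of _ f m]) auto
  show ?case
  proof (cases "u < n")
    case True
    have "u * m + v < Suc u * m" using Suc.prems(3) by simp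
    also have "\<dots> \<le> n * m" using True by (intro mult_right_mono) auto
    finally have "u * m + v < n * m" .
    moreover have "concat (map f [0..<n]) ! (u * m + v) = f u ! v"
      using Suc.IH Suc.prems True by simp
    ultimately show ?thesis
      using len by (simp add: nth_append)
  next
    case False
    then have "u = n" using Suc.prems(2) by simp
    then show ?thesis using len by (simp add: nth_append)
  qed
qed simp

lemma length_encode_rat: "length (encode_rat r) = 2"
  by (simp add: encode_rat_def)

lemma encode_instance:
  assumes "n = card (pverts (network I))"
  shows "length (encode_instance I) = input_length n"
    and "encode_instance I ! 0 = n"
    and "\<lbrakk>u < n; v < n\<rbrakk> \<Longrightarrow>
      encode_instance I ! (7 + 4 * n + u * n + v) = of_bool ((u, v) \<in> parcs (network I))"
proof -
  define pre where "pre = [n] @ encode_rat (capacity I) @ encode_rat (intra_delay I) @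
    encode_rat (inter_delay I) @ concat (map (\<lambda>v. encode_rat (weight I v)) [0..<n]) @
    concat (map (\<lambda>v. encode_rat (vertex_delay I v)) [0..<n])"
  define matrix where "matrix =
    concat (map (\<lambda>u. map (\<lambda>v. if (u, v) \<in> parcs (network I) then 1 else 0 :: nat) [0..<n]) [0..<n])"
  have enc: "encode_instance I = pre @ matrix"
    unfolding encode_instance_def pre_def matrix_def Let_def assms by simp
  have pre: "length pre = 7 + 4 * n"
    unfolding pre_def using length_concat_const[of "[0..<n]" "\<lambda>v. encode_rat (weight I v)" 2]
      length_concat_const[of "[0..<n]" "\<lambda>v. encode_rat (vertex_delay I v)" 2]
    by (simp add: length_encode_rat)
  have matrix: "length matrix = n * n"
    unfolding matrix_def by (subst length_concat_const[of _ _ n]) auto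
  show "length (encode_instance I) = input_length n"
    unfolding enc input_length_def using pre matrix by simp
  show "encode_instance I ! 0 = n"
    unfolding enc by (simp add: pre_def)
  show "encode_instance I ! (7 + 4 * n + u * n + v) = of_bool ((u, v) \<in> parcs (network I))"
    if "u < n" "v < n"
  proof -
    have "encode_instance I ! (7 + 4 * n + u * n + v) = matrix ! (u * n + v)"
      unfolding enc using pre nth_append_length_plus[of pre matrix "u * n + v"] by (simp add: add.assoc)
    also have "\<dots> = of_bool ((u, v) \<in> parcs (network I))"
      unfolding matrix_def using that by (subst nth_concat_const) auto
    finally show ?thesis .
  qed
qed

lemma length_le_input_size: "length xs \<le> input_size xs"
proof (induction xs)
  case (Cons x xs)
  then show ?case
    using bit_length_pos[of x] by (simp add: input_size_def)
qed simp

text \<open>This supplies the initial width that turns \<open>runs\<close> into a time bound. Even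
  the number 0 has \<open>bit_length\<close> 1, hence the nonempty list.\<close>

lemma wide_ram_input:
  assumes "xs \<noteq> []"
  shows "wide (input_size xs) (ram_input xs)"
proof -
  have len: "1 \<le> length xs" using assms by (cases xs) auto
  have le: "bit_length (length xs) \<le> input_size xs"
  proof -
    have "length xs < 2 ^ length xs" by simp
    then have "bit_length (length xs) \<le> length xs"
      using len bit_length_le_iff by blast
    then show ?thesis using length_le_input_size order_trans by blast
  qed
  have zero: "bit_length 0 \<le> input_size xs"
    using le bit_length_mono[of 0 "length xs"] by simp
  have "bit_length (xs ! i) \<le> input_size xs" if "i < length xs" for i
    unfolding input_size_def using that by (intro member_le_sum_list) auto
  then show ?thesis
    unfolding wide_def ram_input_def using le zero by auto
qed

lemma program_size_poly: "\<exists>q :: nat poly. \<forall>n. poly q n = program_size n"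
proof -
  let ?S = "[:1, 1:] :: nat poly"
  define pairs :: "nat \<Rightarrow> nat poly" where
    "pairs k = [:bit_length 5 + exp_size row_start:] + ?S * (?S * [:k + for_size 7:] +
      [:bit_length 5 + exp_size (Add (Reg 5) (Reg 1)):] + [:for_size 6:])" for k
  have pairs: "poly (pairs k) n = pairs_size n k" for k n
    unfolding pairs_def pairs_size_def by (simp add: algebra_simps)
  define q :: "nat poly" where
    "q = [:prog_size init_regs:] + (?S * (pairs (prog_size relax) + [:for_size 8:]) +
      (?S * [:prog_size (Set_Mem (Reg 7) (Reg 7)) + for_size 7:] +
        (pairs (prog_size match) + [:prog_size (Set_Reg 0 (Reg 1)):])))"
  have "poly q n = program_size n" for n
    unfolding q_def program_size_def by (simp add: pairs algebra_simps)
  then show ?thesis by blast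
qed

lemma poly_nat_mono:
  fixes q :: "nat poly"
  assumes "m \<le> n"
  shows "poly q m \<le> poly q n"
  by (induction q) (use assms in \<open>auto intro!: add_mono mult_mono\<close>)

lemma decode_clustering_map:
  "decode_clustering (map l [0..<n]) = (\<lambda>i. {j. j < n \<and> l j = l i}) ` {..<n}"
proof -
  have "{j. j < n \<and> map l [0..<n] ! j = map l [0..<n] ! i} = {j. j < n \<and> l j = l i}" if "i < n" for i
    using that by auto
  then show ?thesis
    unfolding decode_clustering_def by (intro image_cong) auto
qed

lemma partition_on_same_label:
  "partition_on A ((\<lambda>i. {j. j \<in> A \<and> l j = l i}) ` A)"
  by (rule partition_onI) (auto simp: disjnt_def)

theorem theorem4:
  shows "poly_time_approximable 2
    {I. clustering_problem I \<and> capacity I = 2 \<and>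
        (\<forall>v\<in>pverts (network I). weight I v = 1 \<and> vertex_delay I v = 0)}"
proof -
  obtain p :: "nat poly" where p: "\<And>n. poly p n = program_size n"
    using program_size_poly by blast
  \<comment> \<open>At the input size \<open>N\<close> this is \<open>p(N) * (N + p(N))\<close>, the
    time bound of \<open>runs\<close> for width \<open>N\<close> with the step count estimated
    through \<open>n \<le> N\<close>.\<close>
  let ?q = "p * ([:0, 1:] + p)"
  show ?thesis
    unfolding poly_time_approximable_def
  proof (intro exI[of _ program] exI[of _ ?q] ballI impI)
    fix I :: "nat clustering_instance"
    assume I: "I \<in> {I. clustering_problem I \<and> capacity I = 2 \<and>
        (\<forall>v\<in>pverts (network I). weight I v = 1 \<and> vertex_delay I v = 0)}"
      and V: "pverts (network I) = {..<card (pverts (network I))}"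
    interpret unit_clustering I
      using I by unfold_locales auto
    define n where "n = card V"
    have V: "V = {..<n}" using V by (simp add: n_def)
    interpret bounded_rel n E
    proof
      show "E \<subseteq> {..<n} \<times> {..<n}"
        using arc_in_verts V by auto
    qed (use arc_neq relpow_less_card n_def in auto)
    let ?xs = "encode_instance I"
    let ?N = "input_size ?xs"
    note enc = encode_instance[OF n_def]
    have nonempty: "?xs \<noteq> []"
      using enc(1) by (auto simp: input_length_def)
    have "runs program (ram_input ?xs) (program_size n) (\<lambda>s. fst s 0 = n \<and> (\<exists>L. is_longest E L \<and>
      matching_labels n (critical_arcs E L) ({..<n} \<times> {..<n}) (snd s)))"
    proof (rule runs_program)
      fix u v assume "u < n" "v < n"
      then show "snd (ram_input ?xs) (7 + 4 * n + u * n + v) = of_bool ((u, v) \<in> E)"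
        using enc(3) matrix_index_less[of u n v] by (simp add: ram_input_def enc(1))
    qed (use enc nonempty in \<open>auto simp: ram_input_def\<close>)
    then obtain t s L where exec: "ram_exec program (ram_input ?xs) t s" and "fst s 0 = n"
      and L: "is_longest E L"
      and ml: "matching_labels n (critical_arcs E L) ({..<n} \<times> {..<n}) (snd s)"
      and "\<And>w. wide w (ram_input ?xs) \<Longrightarrow> t \<le> program_size n * (w + program_size n)"
      unfolding runs_def by blast
    then have time: "t \<le> program_size n * (?N + program_size n)"
      using wide_ram_input[OF nonempty] by blast
    have F: "critical_arcs E L \<subseteq> {..<n} \<times> {..<n}"
      using field unfolding critical_arcs_def by auto
    define P where "P = (\<lambda>i. {j. j < n \<and> snd s j = snd s i}) ` {..<n}"
    have P: "feasible_clustering I P"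
      unfolding feasible_clustering_def
    proof (intro conjI ballI)
      show "partition_on V P"
        unfolding P_def V using partition_on_same_label[of "{..<n}" "snd s"] by simp
      fix C assume "C \<in> P"
      then have "card C \<le> 2" "C \<subseteq> V"
        unfolding P_def V using matching_labels_class[OF ml F] by auto
      then show "sum (weight I) C \<le> capacity I"
        using capacity sum_weight_eq_card of_nat_mono[of "card C" 2, where 'a = rat] by simp
    qed
    have approx: "network_delay I P \<le> 2 * optimal_delay I"
    proof (rule two_approximation[OF L P])
      fix e
      assume matching: "\<And>u v u' v'. (u, v) \<in> critical_arcs E L \<Longrightarrow> (u', v') \<in> critical_arcs E L \<Longrightarrow>
        {u, v} \<inter> {u', v'} \<noteq> {} \<Longrightarrow> {u, v} = {u', v'}"
        and "e \<in> critical_arcs E L"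
      then obtain u v where e: "e = (u, v)" "(u, v) \<in> critical_arcs E L" by (cases e) auto
      have "snd s u = snd s v"
        by (rule matching_labels_complete[OF ml F matching e(2)])
      then show "together P e"
        using e F unfolding together_def P_def by auto
    qed
    have "ram_computes program ?xs t (map (snd s) [0..<n])"
      unfolding ram_computes_def ram_output_def using exec \<open>fst s 0 = n\<close> by blast
    moreover have "t \<le> poly ?q ?N"
    proof -
      have "n \<le> ?N"
        using length_le_input_size[of ?xs] enc(1) by (simp add: input_length_def)
      then have "program_size n \<le> poly p ?N"
        using poly_nat_mono[of n ?N p] p by simp
      then have "program_size n * (?N + program_size n) \<le> poly p ?N * (?N + poly p ?N)"
        by (intro mult_mono) auto
      then show ?thesis using time by simp
    qed
    ultimately show "\<exists>t ys. ram_computes program ?xs t ys \<and> t \<le> poly ?q ?N \<and>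
      feasible_clustering I (decode_clustering ys) \<and>
      network_delay I (decode_clustering ys) \<le> 2 * optimal_delay I"
      using P approx unfolding P_def decode_clustering_map[symmetric] by blast
  qed
qed

end
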